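(* Let $0<\alpha<\beta<\infty$ and $w\in\mathcal W_{\alpha,\beta}$. Under the reduced Palm distribution $\mathbb P_w^{0,!}$ of $X_w$ at the origin, let $S_w:=\inf(\operatorname{supp}X_w\cap(0,\infty))$, with $\inf\varnothing:=\infty$. Then, as $t\downarrow0$, \[ \mathbb P_w^{0,!}\{S_w\leq t\}=\frac{\rho_w^{(2)}(0)}{\lambda_w}\,t+O_w(t^2), \] where the implicit constant in $O_w(\cdot)$ may depend on $w$. In particular, the leading coefficient $\rho_w^{(2)}(0)/\lambda_w$ is strictly positive.
   Context: $\mathbb H=\{x+iy:x\in\mathbb R,\ y>0\}$ with planar Lebesgue measure $\mathrm dA$. $Z_{\mathbb H}$ is the determinantal point process on $\mathbb H$ with kernel $K_{\mathbb H}(z,\zeta)=-\frac{1}{\pi(z-\overline\zeta)^2}$ relative to $\mathrm dA$, i.e. for every $k\ge1$ its $k$-th factorial moment measure has density $\det[K_{\mathbb H}(z_i,z_j)]_{i,j=1}^k$ with respect to $\mathrm dA^{\otimes k}$. $\mathcal W_{\alpha,\beta}$ is the set of Borel functions $w:(0,\infty)\to[0,1]$ with $w(y)=0$ for $y\notin[\alpha,\beta]$ and $\int_\alpha^\beta w(y)\,\mathrm dy>0$. $M_w$ is obtained from $Z_{\mathbb H}$ by independently retaining each point $z=x+iy$ with probability $w(y)$, and $X_w=\sum_{z\in M_w}\delta_{\operatorname{Re}z}$ is its horizontal projection. $X_w$ is a stationary, locally finite, simple point process on $\mathbb R$ with intensity $\lambda_w=\frac1{4\pi}\int_0^\infty w(y)y^{-2}\,\mathrm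 dy$, and its two-point factorial moment density, as a function of $r=x_2-x_1$, has the continuous representative \[ \rho_w^{(2)}(r)=\lambda_w^2-\frac1{\pi^2}\int_0^\infty\int_0^\infty\frac{w(y)w(v)}{(r^2+(y+v)^2)^2}\,\mathrm dy\,\mathrm dv ,\qquad r\in\mathbb R. \] $\mathcal N_{\mathbb R}$ is the space of locally finite simple counting measures on $\mathbb R$ with the Borel $\sigma$-field of the vague topology; $\theta_x$ is translation by $-x$. The reduced Palm distribution $\mathbb P_w^{0,!}$ of $X_w$ at the origin (a probability measure on $\mathcal N_{\mathbb R}$, with expectation $\mathbb E_w^{0,!}$, the canonical configuration again being written $X_w$) is characterized by $\mathbb E\sum_{x\in X_w}\mathbf 1_B(x)F(\theta_x(X_w-\delta_x))=|B|\lambda_w\,\mathbb E_w^{0,!}[F(X_w)]$ for all bounded Borel $B\subset\mathbb R$ with $|B|>0$ and bounded measurable $F:\mathcal N_{\mathbb R}\to\mathbb R$. *)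

theory Defs
  imports
    "HOL-Probability.Probability"
    "HOL-Library.Landau_Symbols"
    "Jordan_Normal_Form.Determinant"
begin

section \<open>Spaces of locally finite simple counting measures\<close>

definition counting_measure_of :: "'a::topological_space set \<Rightarrow> 'a set \<Rightarrow> 'a measure" where
  "counting_measure_of D S = distr (count_space S) (restrict_space borel D) (\<lambda>x. x)"

text \<open>
  The measure above is the sum of the unit masses at the points of \<open>S\<close>, so \<open>conf D\<close> consists of the
  locally finite simple counting measures on \<open>D\<close>. Local finiteness refers to compact subsets of
  \<open>D\<close>: in the open half-plane, points may accumulate at the real axis.
\<close>

definition conf :: "'a::topological_space set \<Rightarrow> 'a measure set" where
  "conf D = counting_measure_of D ` {S. S \<subseteq> D \<and> (\<forall>K\<subseteq>D. compact K \<longrightarrow> finite (S \<inter> K))}"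

definition test_functions :: "'a::topological_space set \<Rightarrow> ('a \<Rightarrow> real) set" where
  "test_functions D =
     {f. continuous_on D f \<and> (\<exists>K\<subseteq>D. compact K \<and> (\<forall>x\<in>D - K. f x = 0))}"

definition vague_topology :: "'a::topological_space set \<Rightarrow> 'a measure topology" where
  "vague_topology D = topology_generated_by
     {{\<mu> \<in> conf D. integral\<^sup>L \<mu> f \<in> U} | f U. f \<in> test_functions D \<and> open U}"

definition conf_space :: "'a::topological_space set \<Rightarrow> 'a measure measure" where
  "conf_space D = sigma (conf D) {A. openin (vague_topology D) A}"

definition points :: "'a measure \<Rightarrow> 'a set" where
  "points \<mu> = {x \<in> space \<mu>. emeasure \<mu> {x} \<noteq> 0}"

definition supp :: "'a::topological_space measure \<Rightarrow> 'a set" where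
  "supp \<mu> = {x. \<forall>U. open U \<and> x \<in> U \<longrightarrow> emeasure \<mu> U \<noteq> 0}"


section \<open>Determinantal processes, independent thinning, reduced Palm distributions\<close>

text \<open>
  The \<open>k\<close>-th factorial moment measure of a set \<open>A\<close>: the expected number of \<open>k\<close>-tuples of pairwise
  distinct points of the process that lie in \<open>A\<close>. Tuples are extensional functions on \<open>{..<k}\<close>, as
  in \<open>PiM {..<k}\<close>.
\<close>

definition factorial_moment ::
    "'w measure \<Rightarrow> ('w \<Rightarrow> 'a measure) \<Rightarrow> nat \<Rightarrow> (nat \<Rightarrow> 'a) set \<Rightarrow> ennreal" where
  "factorial_moment \<Omega> Z k A =
     (\<integral>\<^sup>+\<omega>. emeasure (count_space UNIV)
        {x \<in> A. inj_on x {..<k} \<and> x ` {..<k} \<subseteq> points (Z \<omega>)} \<partial>\<Omega>)"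

text \<open>
  For a Hermitian kernel the determinant below is real; taking the real part only changes its type.
\<close>

definition determinantal_process ::
    "'w measure \<Rightarrow> ('w \<Rightarrow> 'a::euclidean_space measure) \<Rightarrow> 'a set \<Rightarrow> ('a \<Rightarrow> 'a \<Rightarrow> complex) \<Rightarrow> bool" where
  "determinantal_process \<Omega> Z D K \<longleftrightarrow>
     Z \<in> measurable \<Omega> (conf_space D) \<and>
     (\<forall>k\<ge>1. \<forall>A\<in>sets (\<Pi>\<^sub>M i\<in>{..<k}. restrict_space lborel D).
        factorial_moment \<Omega> Z k A =
        (\<integral>\<^sup>+x\<in>A. ennreal (Re (Determinant.det (Matrix.mat k k (\<lambda>(i, j). K (x i) (x j)))))
           \<partial>(\<Pi>\<^sub>M i\<in>{..<k}. restrict_space lborel D)))"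

text \<open>
  Conditionally on \<open>Z\<close>, the process \<open>M\<close> keeps the points \<open>z\<close> of \<open>Z\<close> according to independent
  Bernoulli variables \<open>g z\<close> with success probability \<open>p z\<close>. The equation determines the joint law
  of \<open>Z\<close> and \<open>M\<close> from the law of \<open>Z\<close>.
\<close>

definition independent_thinning ::
    "'w measure \<Rightarrow> ('w \<Rightarrow> 'a measure) \<Rightarrow> ('w \<Rightarrow> 'a measure) \<Rightarrow> 'a::topological_space set \<Rightarrow> ('a \<Rightarrow> real) \<Rightarrow> bool"
  where
  "independent_thinning \<Omega> Z M D p \<longleftrightarrow>
     M \<in> measurable \<Omega> (conf_space D) \<and>
     (\<forall>f \<in> borel_measurable (conf_space D \<Otimes>\<^sub>M conf_space D).
        (\<integral>\<^sup>+\<omega>. f (Z \<omega>, M \<omega>) \<partial>\<Omega>) =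
        (\<integral>\<^sup>+\<omega>. (\<integral>\<^sup>+g. f (Z \<omega>, counting_measure_of D {z \<in> points (Z \<omega>). g z})
           \<partial>(\<Pi>\<^sub>M z\<in>points (Z \<omega>). measure_pmf (bernoulli_pmf (p z)))) \<partial>\<Omega>))"

definition shift :: "real \<Rightarrow> real measure \<Rightarrow> real measure" where
  "shift x \<mu> = distr \<mu> borel (\<lambda>y. y - x)"

definition reduced_palm ::
    "'w measure \<Rightarrow> ('w \<Rightarrow> real measure) \<Rightarrow> real \<Rightarrow> real measure measure \<Rightarrow> bool" where
  "reduced_palm \<Omega> X l P \<longleftrightarrow>
     prob_space P \<and> sets P = sets (conf_space UNIV) \<and>
     (\<forall>B F. B \<in> sets borel \<and> bounded B \<and> measure lborel B > 0 \<and>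
        F \<in> borel_measurable (conf_space UNIV) \<and> bounded (F ` conf UNIV) \<longrightarrow>
        (\<integral>\<omega>. (\<Sum>x\<in>points (X \<omega>) \<inter> B. F (shift x (diff_measure (X \<omega>) (return borel x)))) \<partial>\<Omega>) =
        measure lborel B * l * (\<integral>\<mu>. F \<mu> \<partial>P))"


section \<open>The thinned half-plane process and its projection\<close>

definition upper_half_plane :: "complex set" where
  "upper_half_plane = {z. Im z > 0}"

definition K_H :: "complex \<Rightarrow> complex \<Rightarrow> complex" where
  "K_H z \<zeta> = - 1 / (of_real pi * (z - cnj \<zeta>)\<^sup>2)"

text \<open>The values of \<open>w\<close> outside \<open>(0, \<infinity>)\<close> are irrelevant throughout.\<close>

definition retention_class :: "real \<Rightarrow> real \<Rightarrow> (real \<Rightarrow> real) set" where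
  "retention_class \<alpha> \<beta> =
     {w. w \<in> borel_measurable (restrict_space borel {0<..}) \<and>
         (\<forall>y>0. 0 \<le> w y \<and> w y \<le> 1) \<and>
         (\<forall>y>0. y \<notin> {\<alpha>..\<beta>} \<longrightarrow> w y = 0) \<and>
         (LINT y:{\<alpha>..\<beta>}|lborel. w y) > 0}"

definition intensity :: "(real \<Rightarrow> real) \<Rightarrow> real" where
  "intensity w = 1 / (4 * pi) * (LINT y:{0<..}|lborel. w y / y\<^sup>2)"

definition rho2 :: "(real \<Rightarrow> real) \<Rightarrow> real \<Rightarrow> real" where
  "rho2 w r = (intensity w)\<^sup>2 - 1 / pi\<^sup>2 *
     (LINT y:{0<..}|lborel. LINT v:{0<..}|lborel. w y * w v / (r\<^sup>2 + (y + v)\<^sup>2)\<^sup>2)"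

text \<open>
  The projection of a configuration in the half-plane need not be locally finite or simple, but that
  of \<open>M\<close> almost surely is; \<open>X\<close> is a point process on the line that agrees with it almost surely.
\<close>

definition projected_process ::
    "'w measure \<Rightarrow> ('w \<Rightarrow> complex measure) \<Rightarrow> ('w \<Rightarrow> real measure) \<Rightarrow> bool" where
  "projected_process \<Omega> M X \<longleftrightarrow>
     X \<in> measurable \<Omega> (conf_space UNIV) \<and> (AE \<omega> in \<Omega>. X \<omega> = distr (M \<omega>) borel Re)"

definition first_positive_point :: "real measure \<Rightarrow> ereal" where
  "first_positive_point \<mu> = Inf (ereal ` (supp \<mu> \<inter> {0<..}))"

end

theory Submission
  imports Defs
begin

text \<open>
  By the Palm formula over the unit interval, \<open>\<lambda>\<^sub>w P (S\<^sub>w \<le> t)\<close> is the expected number of points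
  \<open>x \<in> [0, 1]\<close> of \<open>X\<^sub>w\<close> that have another point in \<open>(x, x + t]\<close>. Since
  \<open>n - n (n - 1) \<le> 1\<^bsub>n \<ge> 1\<^esub> \<le> n\<close>, this number lies between the expected number of ordered pairs
  of points at distance at most \<open>t\<close>, and the same minus the expected number of triples. Independent
  thinning multiplies the factorial moment densities of the half-plane process by the retention
  probabilities, so these expectations are integrals of \<open>2 \<times> 2\<close> and \<open>3 \<times> 3\<close> determinants. On the
  strip that carries \<open>w\<close> the determinants are bounded, whence the triples contribute \<open>O(t\<^sup>2)\<close>, and the
  pair density differs from its value at \<open>r = 0\<close> by \<open>O(r\<^sup>2)\<close>. Positivity of the coefficient is the
  strict inequality \<open>(y + v)\<^sup>4 > 16 y\<^sup>2 v\<^sup>2\<close> for \<open>y \<noteq> v\<close>.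
\<close>

section \<open>Measurability of functionals of configurations\<close>

text \<open>The coefficient is positive because projecting destroys repulsion: the pair density of
  the half-plane process vanishes when two points merge, but two points above the same abscissa at
  different heights keep a positive density, and equal heights form a null set.

  The first obstacle is measurability. The vague \<sigma>-field directly offers only integrals of
  continuous functions with compact support in the domain, whereas the argument needs sums over
  tuples of points and the event that a point has a neighbour within distance \<open>t\<close>. Both
  are obtained by integrating against the configuration as a kernel, one coordinate at a time.

  Pairs and triples are counted in the half-plane, where the densities are explicit; the comparison
  with the projected process then holds configuration by configuration. All moment bounds are
  additive inequalities between extended nonnegative numbers, so that no difference of possibly
  infinite quantities occurs. Real numbers return only after the pair bound has shown the
  expectation to be finite.\<close>

lemma sets_counting_measure_of [simp, measurable_cong]:
  "sets (counting_measure_of D S) = sets (restrict_space borel D)"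
  by (simp add: counting_measure_of_def)

lemma space_counting_measure_of [simp]: "space (counting_measure_of D S) = D"
  by (simp add: counting_measure_of_def space_restrict_space)

lemma nn_integral_counting_measure_of:
  assumes "S \<subseteq> D" "f \<in> borel_measurable (restrict_space borel D)"
  shows "(\<integral>\<^sup>+x. f x \<partial>counting_measure_of D S) = (\<integral>\<^sup>+x. f x \<partial>count_space S)"
  unfolding counting_measure_of_def
  using assms by (subst nn_integral_distr) (auto simp: space_restrict_space)

lemma emeasure_counting_measure_of:
  assumes "S \<subseteq> D" "A \<in> sets (restrict_space borel D)"
  shows "emeasure (counting_measure_of D S) A = emeasure (count_space S) (S \<inter> A)"
  unfolding counting_measure_of_def
  using assms by (subst emeasure_distr) (auto simp: space_restrict_space Int_commute)

lemma singleton_sets_restrict_borel: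
  fixes x :: "'a::t1_space"
  assumes "x \<in> D" shows "{x} \<in> sets (restrict_space borel D)"
proof -
  have "{x} = D \<inter> {x}" using assms by auto
  moreover have "{x} \<in> sets borel" by simp
  ultimately show ?thesis unfolding sets_restrict_space by (rule image_eqI)
qed

lemma points_counting_measure_of:
  fixes S :: "'a::t1_space set"
  assumes "S \<subseteq> D"
  shows "points (counting_measure_of D S) = S"
proof -
  have "emeasure (counting_measure_of D S) {x} = (if x \<in> S then 1 else 0)" if "x \<in> D" for x
    using emeasure_counting_measure_of[OF assms singleton_sets_restrict_borel[OF that]] by auto
  then show ?thesis using assms by (auto simp: points_def split: if_splits)
qed

text \<open>The representing set of a configuration is unique, being its set of atoms. This rule
  turns statements about measures in \<open>conf D\<close> into statements about
  \<open>points\<close>.\<close>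

lemma confE:
  fixes \<mu> :: "'a::t1_space measure"
  assumes "\<mu> \<in> conf D"
  obtains "\<mu> = counting_measure_of D (points \<mu>)" "points \<mu> \<subseteq> D"
    "\<And>K. K \<subseteq> D \<Longrightarrow> compact K \<Longrightarrow> finite (points \<mu> \<inter> K)"
proof -
  from assms obtain S where S: "S \<subseteq> D" "\<mu> = counting_measure_of D S"
    "\<forall>K\<subseteq>D. compact K \<longrightarrow> finite (S \<inter> K)" by (auto simp: conf_def)
  have "points \<mu> = S" using S(2) points_counting_measure_of[OF S(1)] by simp
  with S show ?thesis by (intro that) simp_all
qed

lemma sets_conf [simp]: "\<mu> \<in> conf D \<Longrightarrow> sets \<mu> = sets (restrict_space borel D)"
  by (auto simp: conf_def)

lemma space_conf [simp]: "\<mu> \<in> conf D \<Longrightarrow> space \<mu> = D"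
  by (auto simp: conf_def)

lemma nn_integral_conf:
  fixes \<mu> :: "'a::t1_space measure"
  assumes "\<mu> \<in> conf D" "f \<in> borel_measurable (restrict_space borel D)"
  shows "(\<integral>\<^sup>+x. f x \<partial>\<mu>) = (\<integral>\<^sup>+x. f x \<partial>count_space (points \<mu>))"
  using assms(1) by (rule confE) (metis assms(2) nn_integral_counting_measure_of)

section \<open>The vague \<sigma>-field and integrals of test functions\<close>

lemma openin_vague_subset: "openin (vague_topology D) A \<Longrightarrow> A \<subseteq> conf D"
  unfolding vague_topology_def
  using openin_subset[of "topology_generated_by
     {{\<mu> \<in> conf D. integral\<^sup>L \<mu> f \<in> U} | f U. f \<in> test_functions D \<and> open U}" A] by auto

lemma space_conf_space [simp]: "space (conf_space D) = conf D"
  using openin_vague_subset by (auto simp: conf_space_def space_measure_of_conv)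

lemma sets_conf_space:
  "sets (conf_space D) = sigma_sets (conf D) {A. openin (vague_topology D) A}"
  using openin_vague_subset by (auto simp: conf_space_def intro!: sets_measure_of)

text \<open>Preimages of open sets under this integral are the subbasic open sets of the vague
  topology. All later measurability on configuration spaces rests on this fact.\<close>

lemma measurable_integral_test_function:
  assumes "f \<in> test_functions D"
  shows "(\<lambda>\<mu>. integral\<^sup>L \<mu> f) \<in> borel_measurable (conf_space D)"
proof (rule borel_measurableI)
  fix U :: "real set" assume "open U"
  have "openin (vague_topology D) {\<mu> \<in> conf D. integral\<^sup>L \<mu> f \<in> U}"
    unfolding vague_topology_def
    using assms \<open>open U\<close> by (intro topology_generated_by_Basis) auto
  moreover have "(\<lambda>\<mu>. integral\<^sup>L \<mu> f) -` U \<inter> space (conf_space D) = {\<mu> \<in> conf D. integral\<^sup>L \<mu> f \<in> U}"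
    by auto
  ultimately show "(\<lambda>\<mu>. integral\<^sup>L \<mu> f) -` U \<inter> space (conf_space D) \<in> sets (conf_space D)"
    unfolding sets_conf_space by auto
qed

lemma nn_integral_test_function_finite:
  fixes f :: "'a::t1_space \<Rightarrow> real"
  assumes "f \<in> test_functions D" "\<mu> \<in> conf D"
  shows "(\<integral>\<^sup>+x. ennreal (f x) \<partial>\<mu>) < \<infinity>"
proof -
  from assms(1) obtain K where K: "K \<subseteq> D" "compact K" "\<And>x. x \<in> D - K \<Longrightarrow> f x = 0"
    and c: "continuous_on D f" by (auto simp: test_functions_def)
  from assms(2) have S: "points \<mu> \<subseteq> D" "finite (points \<mu> \<inter> K)"
    using K by (auto elim!: confE)
  have "(\<integral>\<^sup>+x. ennreal (f x) \<partial>\<mu>) = (\<integral>\<^sup>+x. ennreal (f x) \<partial>count_space (points \<mu>))"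
    using borel_measurable_continuous_on_restrict[OF c] assms(2) by (intro nn_integral_conf) auto
  also have "\<dots> = (\<Sum>x\<in>points \<mu> \<inter> K. ennreal (f x))"
    using S K by (intro nn_integral_count_space') auto
  also have "\<dots> < \<infinity>" using S(2) by (simp add: less_top[symmetric])
  finally show ?thesis .
qed

lemma measurable_nn_integral_test_function:
  fixes f :: "'a::t1_space \<Rightarrow> real"
  assumes "f \<in> test_functions D" "\<And>x. 0 \<le> f x"
  shows "(\<lambda>\<mu>. \<integral>\<^sup>+x. ennreal (f x) \<partial>\<mu>) \<in> borel_measurable (conf_space D)"
proof -
  have "(\<integral>\<^sup>+x. ennreal (f x) \<partial>\<mu>) = ennreal (integral\<^sup>L \<mu> f)" if "\<mu> \<in> conf D" for \<mu>
  proof (rule nn_integral_eq_integral)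
    have c: "continuous_on D f" using assms(1) by (auto simp: test_functions_def)
    have "f \<in> borel_measurable \<mu>"
      using borel_measurable_continuous_on_restrict[OF c] that by (subst measurable_cong_sets) auto
    then show "integrable \<mu> f"
      using nn_integral_test_function_finite[OF assms(1) that] assms(2)
      by (intro integrableI_nonneg) auto
  qed (use assms in auto)
  then have eq: "(\<integral>\<^sup>+x. ennreal (f x) \<partial>\<mu>) = ennreal (integral\<^sup>L \<mu> f)" if "\<mu> \<in> space (conf_space D)" for \<mu>
    using that by simp
  have "(\<lambda>\<mu>. ennreal (integral\<^sup>L \<mu> f)) \<in> borel_measurable (conf_space D)"
    using measurable_integral_test_function[OF assms(1)] by measurable
  then show ?thesis by (rule measurable_cong[THEN iffD2, rotated]) (rule eq)
qed

section \<open>Continuous approximation of open sets, and integration against a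
  configuration\<close>

lemma indicator_open_eq_SUP_continuous:
  fixes U :: "'a::metric_space set"
  assumes "open U"
  obtains h :: "nat \<Rightarrow> 'a \<Rightarrow> real" where
    "\<And>m. continuous_on UNIV (h m)" "\<And>m x. 0 \<le> h m x" "incseq h"
    "\<And>x. (SUP m. ennreal (h m x)) = indicator U x"
proof (cases "U = UNIV")
  \<comment> \<open>\<open>infdist\<close> to the empty set is 0 by convention, so the ramp
    functions of the other case would vanish identically here.\<close>
  case True
  show ?thesis by (rule that[of "\<lambda>_ _. 1"]) (auto simp: True incseq_def)
next
  case False
  define h where "h m x = min 1 (real m * infdist x (- U))" for m x
  have ne: "- U \<noteq> {}" using False by auto
  show ?thesis
  proof (rule that[of h])
    show "continuous_on UNIV (h m)" for m unfolding h_def by (intro continuous_intros)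
    show "0 \<le> h m x" for m x by (simp add: h_def infdist_nonneg)
    show inc: "incseq h"
      unfolding incseq_def h_def le_fun_def
      by (auto intro!: min.coboundedI2 mult_right_mono simp: infdist_nonneg)
    fix x
    show "(SUP m. ennreal (h m x)) = indicator U x"
    proof (cases "x \<in> U")
      case True
      have "closed (- U)" using assms by (simp add: open_closed)
      then have "infdist x (- U) > 0"
        using ne True by (metis ComplD in_closed_iff_infdist_zero infdist_nonneg less_eq_real_def)
      then obtain m where "1 < real m * infdist x (- U)" using reals_Archimedean3 by blast
      then have "h m x = 1" by (simp add: h_def)
      then have "1 \<le> (SUP m. ennreal (h m x))" by (intro SUP_upper2[of m]) auto
      moreover have "(SUP m. ennreal (h m x)) \<le> 1" by (intro SUP_least) (auto simp: h_def)
      ultimately show ?thesis using True by auto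
    next
      case False
      then show ?thesis by (auto simp: h_def)
    qed
  qed
qed

text \<open>Continuous cut-offs take the place of an exhaustion by compact sets, because only
  continuous integrands give measurable integrals at the outset.\<close>

definition exhaustion :: "'a::metric_space set \<Rightarrow> (nat \<Rightarrow> 'a \<Rightarrow> real) \<Rightarrow> bool" where
  "exhaustion D g \<longleftrightarrow>
     (\<forall>n. continuous_on UNIV (g n) \<and> (\<exists>K\<subseteq>D. compact K \<and> (\<forall>x. x \<notin> K \<longrightarrow> g n x = 0))) \<and>
     (\<forall>n x. 0 \<le> g n x) \<and> incseq g \<and> (\<forall>x. (SUP n. ennreal (g n x)) = indicator D x)"

lemma exhaustion_mult_test_function:
  assumes "exhaustion D g" "continuous_on UNIV h"
  shows "(\<lambda>x. g n x * h x) \<in> test_functions D"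
proof -
  from assms(1) obtain K where "K \<subseteq> D" "compact K" "\<And>x. x \<notin> K \<Longrightarrow> g n x = 0" "continuous_on UNIV (g n)"
    unfolding exhaustion_def by blast
  then show ?thesis
    unfolding test_functions_def using assms(2)
    by (auto intro!: continuous_intros exI[of _ K] intro: continuous_on_subset)
qed

lemma exhaustion_borel_measurable:
  "exhaustion D g \<Longrightarrow> g n \<in> borel_measurable borel"
  by (auto simp: exhaustion_def intro: borel_measurable_continuous_onI)

lemma restrict_borel_eq_sigma_sets_open:
  assumes "D \<in> sets borel"
  shows "sets (restrict_space borel D) = sigma_sets D {D \<inter> U | U. open U}"
proof -
  have "sets (restrict_space borel D) = (\<inter>) D ` sigma_sets UNIV {S. open S}"
    by (simp add: sets_restrict_space sets_borel)
  also have "\<dots> = sigma_sets D ((\<inter>) D ` {S. open S})"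
    using assms by (intro sigma_sets_Int) (auto simp: sets_borel)
  also have "(\<inter>) D ` {S. open S} = {D \<inter> U | U. open U}" by auto
  finally show ?thesis .
qed

text \<open>The sets where the cut-offs are nonzero cover \<open>D\<close>, and each meets the
  configuration in a finite set. Countability is what allows Tonelli for counting measures on the
  points and on tuples of them.\<close>

lemma countable_points_conf:
  assumes "exhaustion D g" "\<mu> \<in> conf D"
  shows "countable (points \<mu>)"
proof -
  have pD: "points \<mu> \<subseteq> D" using assms(2) by (auto elim: confE)
  have "countable (\<Union>n. {x \<in> points \<mu>. g n x \<noteq> 0})"
  proof (intro countable_UN)
    fix n
    from assms(1) obtain K where K: "K \<subseteq> D" "compact K" "\<And>x. x \<notin> K \<Longrightarrow> g n x = 0"
      unfolding exhaustion_def by blast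
    have "finite (points \<mu> \<inter> K)" using assms(2) K(1,2) by (auto elim: confE)
    then have "finite {x \<in> points \<mu>. g n x \<noteq> 0}" by (rule rev_finite_subset) (use K(3) in blast)
    then show "countable {x \<in> points \<mu>. g n x \<noteq> 0}" by (rule countable_finite)
  qed auto
  moreover have "points \<mu> \<subseteq> (\<Union>n. {x \<in> points \<mu>. g n x \<noteq> 0})"
  proof
    fix x assume x: "x \<in> points \<mu>"
    have "\<exists>n. g n x \<noteq> 0"
    proof (rule ccontr)
      assume "\<not> ?thesis"
      then have "(SUP n. ennreal (g n x)) = 0" by simp
      then show False using assms(1) x pD unfolding exhaustion_def by auto
    qed
    then show "x \<in> (\<Union>n. {x \<in> points \<mu>. g n x \<noteq> 0})" using x by auto
  qed
  ultimately show ?thesis by (rule countable_subset[rotated])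
qed

text \<open>Multiplying a configuration by a test function and dividing by the total mass gives a
  sub-probability kernel, to which the library results on the Giry monad apply.\<close>

lemma measurable_nn_integral_conf_kernel:
  assumes D: "D \<in> sets borel" "D \<noteq> {}" and g: "exhaustion D g"
    and \<kappa>: "\<kappa> \<in> measurable N (conf_space D)"
    and f: "(\<lambda>(a, x). f a x) \<in> borel_measurable (N \<Otimes>\<^sub>M restrict_space borel D)"
  shows "(\<lambda>a. \<integral>\<^sup>+x. f a x \<partial>\<kappa> a) \<in> borel_measurable N"
proof -
  let ?R = "restrict_space borel D"
  have \<kappa>c: "\<kappa> a \<in> conf D" if "a \<in> space N" for a
    using measurable_space[OF \<kappa> that] by simp
  have fa: "f a \<in> borel_measurable (\<kappa> a)" if "a \<in> space N" for a
    using measurable_Pair2[OF f, of a] that \<kappa>c[OF that] by (simp cong: measurable_cong_sets)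
  have gm: "(\<lambda>x. ennreal (g n x)) \<in> borel_measurable ?R" for n
    using exhaustion_borel_measurable[OF g, of n] by (auto intro: measurable_restrict_space1)
  have gt: "g n \<in> test_functions D" for n
    using exhaustion_mult_test_function[OF g, of "\<lambda>_. 1" n] by simp
  have g0: "0 \<le> g n x" for n x using g by (auto simp: exhaustion_def)
  have part: "(\<lambda>a. \<integral>\<^sup>+x. f a x * ennreal (g n x) \<partial>\<kappa> a) \<in> borel_measurable N" for n
  proof -
    \<comment> \<open>The summand 1 keeps the divisor nonzero on configurations without points where
      \<open>g n\<close> is positive.\<close>
    define c where "c a = 1 + (\<integral>\<^sup>+x. ennreal (g n x) \<partial>\<kappa> a)" for a
    have c_meas[measurable]: "c \<in> borel_measurable N"
      unfolding c_def using measurable_compose[OF \<kappa> measurable_nn_integral_test_function[OF gt g0]]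
      by simp
    have c_fin: "c a < \<infinity>" "c a \<noteq> 0" if "a \<in> space N" for a
      using nn_integral_test_function_finite[OF gt \<kappa>c[OF that]] by (auto simp: c_def)
    define L where "L a = density (\<kappa> a) (\<lambda>x. ennreal (g n x) / c a)" for a
    have gk: "(\<lambda>x. ennreal (g n x)) \<in> borel_measurable (\<kappa> a)" if "a \<in> space N" for a
      using gm \<kappa>c[OF that] by (simp cong: measurable_cong_sets)
    have eL: "emeasure (L a) A = (\<integral>\<^sup>+x. ennreal (g n x) * indicator A x \<partial>\<kappa> a) / c a"
      if "a \<in> space N" "A \<in> sets ?R" for a A
    proof -
      have A: "A \<in> sets (\<kappa> a)" using that \<kappa>c[OF that(1)] by simp
      have "emeasure (L a) A = (\<integral>\<^sup>+x. ennreal (g n x) / c a * indicator A x \<partial>\<kappa> a)"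
        unfolding L_def using gk[OF that(1)] A by (intro emeasure_density) auto
      also have "\<dots> = (\<integral>\<^sup>+x. ennreal (g n x) * indicator A x / c a \<partial>\<kappa> a)"
        by (intro nn_integral_cong) (auto simp: indicator_def)
      also have "\<dots> = (\<integral>\<^sup>+x. ennreal (g n x) * indicator A x \<partial>\<kappa> a) / c a"
        using gk[OF that(1)] A by (intro nn_integral_divide) auto
      finally show ?thesis .
    qed
    have DR: "D \<in> sets ?R" using sets.top[of ?R] by (simp add: space_restrict_space)
    have UR: "D \<inter> U \<in> sets ?R" if "open U" for U using that by (auto simp: sets_restrict_space)
    \<comment> \<open>Relatively open sets form an intersection-stable generator, and on them the
      mass is a limit of integrals of the test functions \<open>g n * h m\<close>.\<close>
    have eLU: "(\<lambda>a. emeasure (L a) (D \<inter> U)) \<in> borel_measurable N" if U: "open U" for U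
    proof -
      obtain h :: "nat \<Rightarrow> 'a \<Rightarrow> real" where h: "\<And>m. continuous_on UNIV (h m)" "\<And>m x. 0 \<le> h m x"
        "incseq h" "\<And>x. (SUP m. ennreal (h m x)) = indicator U x"
        using indicator_open_eq_SUP_continuous[OF U] by blast
      have eq: "emeasure (L a) (D \<inter> U) = (SUP m. \<integral>\<^sup>+x. ennreal (g n x * h m x) \<partial>\<kappa> a) / c a"
        if a: "a \<in> space N" for a
      proof -
        have "(\<integral>\<^sup>+x. ennreal (g n x) * indicator (D \<inter> U) x \<partial>\<kappa> a)
            = (\<integral>\<^sup>+x. (SUP m. ennreal (g n x * h m x)) \<partial>\<kappa> a)"
        proof (intro nn_integral_cong)
          fix x assume "x \<in> space (\<kappa> a)"
          then have "x \<in> D" using \<kappa>c[OF a] by simp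
          then show "ennreal (g n x) * indicator (D \<inter> U) x = (SUP m. ennreal (g n x * h m x))"
            using g0 h(2) by (simp add: ennreal_mult SUP_mult_left_ennreal[symmetric] h(4) indicator_def)
        qed
        also have "\<dots> = (SUP m. \<integral>\<^sup>+x. ennreal (g n x * h m x) \<partial>\<kappa> a)"
        proof (rule nn_integral_monotone_convergence_SUP)
          show "incseq (\<lambda>i x. ennreal (g n x * h i x))"
            using h(3) g0 by (auto simp: incseq_def le_fun_def intro!: ennreal_leI mult_left_mono)
          have "h m \<in> borel_measurable ?R" for m
            using borel_measurable_continuous_onI[OF h(1)] by (auto intro: measurable_restrict_space1)
          moreover have "g n \<in> borel_measurable ?R"
            using exhaustion_borel_measurable[OF g, of n] by (auto intro: measurable_restrict_space1)
          ultimately have "(\<lambda>x. ennreal (g n x * h m x)) \<in> borel_measurable ?R" for m by measurable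
          then show "(\<lambda>x. ennreal (g n x * h m x)) \<in> borel_measurable (\<kappa> a)" for m
            using \<kappa>c[OF a] by (simp cong: measurable_cong_sets)
        qed
        finally show ?thesis using eL[OF a UR[OF U]] by simp
      qed
      have "(\<lambda>a. \<integral>\<^sup>+x. ennreal (g n x * h m x) \<partial>\<kappa> a) \<in> borel_measurable N" for m
        using measurable_compose[OF \<kappa> measurable_nn_integral_test_function
            [OF exhaustion_mult_test_function[OF g h(1)]]] g0 h(2) by simp
      then have "(\<lambda>a. (SUP m. \<integral>\<^sup>+x. ennreal (g n x * h m x) \<partial>\<kappa> a) / c a) \<in> borel_measurable N"
        by measurable
      then show ?thesis by (rule measurable_cong[THEN iffD2, rotated]) (rule eq)
    qed
    have "L \<in> measurable N (subprob_algebra ?R)"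
    proof (rule measurable_subprob_algebra_generated[OF restrict_borel_eq_sigma_sets_open[OF D(1)]])
      show "Int_stable {D \<inter> U |U. open U}"
        unfolding Int_stable_def
      proof (intro ballI)
        fix A B assume "A \<in> {D \<inter> U |U. open U}" "B \<in> {D \<inter> U |U. open U}"
        then obtain U V where "A = D \<inter> U" "B = D \<inter> V" "open U" "open V" by auto
        then show "A \<inter> B \<in> {D \<inter> U |U. open U}" by (intro CollectI exI[of _ "U \<inter> V"]) auto
      qed
      show "subprob_space (L a)" if a: "a \<in> space N" for a
      proof
        have eq: "emeasure (L a) (space (L a)) = (\<integral>\<^sup>+x. ennreal (g n x) * indicator D x \<partial>\<kappa> a) / c a"
          using eL[OF a DR] \<kappa>c[OF a] by (simp add: L_def)
        have "(\<integral>\<^sup>+x. ennreal (g n x) * indicator D x \<partial>\<kappa> a) \<le> c a"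
          unfolding c_def by (intro order.trans[OF nn_integral_mono add_increasing[OF _ order_refl]])
            (auto simp: indicator_def)
        then have "(\<integral>\<^sup>+x. ennreal (g n x) * indicator D x \<partial>\<kappa> a) / c a \<le> c a / c a"
          by (rule divide_right_mono_ennreal)
        also have "c a / c a = 1" using c_fin[OF a] by (simp add: ennreal_divide_self)
        finally show "emeasure (L a) (space (L a)) \<le> 1" unfolding eq .
        show "space (L a) \<noteq> {}" using D \<kappa>c[OF a] by (simp add: L_def)
      qed
      show "sets (L a) = sets ?R" if "a \<in> space N" for a using \<kappa>c[OF that] by (simp add: L_def)
      show "(\<lambda>a. emeasure (L a) A) \<in> borel_measurable N" if "A \<in> {D \<inter> U |U. open U}" for A
        using eLU that by auto
      show "(\<lambda>a. emeasure (L a) D) \<in> borel_measurable N" using eLU[of UNIV] by simp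
    qed auto
    from nn_integral_measurable_subprob_algebra2[OF f this]
    have meas: "(\<lambda>a. c a * (\<integral>\<^sup>+x. f a x \<partial>L a)) \<in> borel_measurable N" by measurable
    have eq: "c a * (\<integral>\<^sup>+x. f a x \<partial>L a) = (\<integral>\<^sup>+x. f a x * ennreal (g n x) \<partial>\<kappa> a)"
      if a: "a \<in> space N" for a
    proof -
      have [measurable]: "f a \<in> borel_measurable (\<kappa> a)" "(\<lambda>x. ennreal (g n x)) \<in> borel_measurable (\<kappa> a)"
        using fa[OF a] gk[OF a] by auto
      have "(\<integral>\<^sup>+x. f a x \<partial>L a) = (\<integral>\<^sup>+x. ennreal (g n x) / c a * f a x \<partial>\<kappa> a)"
        unfolding L_def by (intro nn_integral_density) auto
      then have "c a * (\<integral>\<^sup>+x. f a x \<partial>L a) = (\<integral>\<^sup>+x. c a * (ennreal (g n x) / c a * f a x) \<partial>\<kappa> a)"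
        by (simp add: nn_integral_cmult)
      also have "\<dots> = (\<integral>\<^sup>+x. f a x * ennreal (g n x) \<partial>\<kappa> a)"
      proof (intro nn_integral_cong)
        fix x
        have "c a * (ennreal (g n x) / c a * f a x) = (c a / c a) * ennreal (g n x) * f a x"
          by (simp add: divide_ennreal_def algebra_simps)
        also have "c a / c a = 1" using c_fin[OF a] by (simp add: ennreal_divide_self)
        finally show "c a * (ennreal (g n x) / c a * f a x) = f a x * ennreal (g n x)" by (simp add: mult.commute)
      qed
      finally show ?thesis .
    qed
    from meas show ?thesis by (rule measurable_cong[THEN iffD2, rotated]) (rule eq[symmetric])
  qed
  \<comment> \<open>The cut-offs increase to 1 on \<open>D\<close>, so monotone convergence removes
    them.\<close>
  have eq: "(\<integral>\<^sup>+x. f a x \<partial>\<kappa> a) = (SUP n. \<integral>\<^sup>+x. f a x * ennreal (g n x) \<partial>\<kappa> a)" if a: "a \<in> space N" for a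
  proof -
    have "(\<integral>\<^sup>+x. f a x \<partial>\<kappa> a) = (\<integral>\<^sup>+x. (SUP n. f a x * ennreal (g n x)) \<partial>\<kappa> a)"
    proof (intro nn_integral_cong)
      fix x assume "x \<in> space (\<kappa> a)"
      then have "x \<in> D" using \<kappa>c[OF a] by simp
      then show "f a x = (SUP n. f a x * ennreal (g n x))"
        using g by (simp add: SUP_mult_left_ennreal[symmetric] exhaustion_def)
    qed
    also have "\<dots> = (SUP n. \<integral>\<^sup>+x. f a x * ennreal (g n x) \<partial>\<kappa> a)"
    proof (rule nn_integral_monotone_convergence_SUP)
      show "incseq (\<lambda>n x. f a x * ennreal (g n x))"
        using g by (auto simp: exhaustion_def incseq_def le_fun_def intro!: mult_left_mono ennreal_leI)
      have "(\<lambda>x. ennreal (g n x)) \<in> borel_measurable (\<kappa> a)" for n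
        using gm \<kappa>c[OF a] by (simp cong: measurable_cong_sets)
      then show "(\<lambda>x. f a x * ennreal (g n x)) \<in> borel_measurable (\<kappa> a)" for n
        using fa[OF a] by measurable
    qed
    finally show ?thesis .
  qed
  have "(\<lambda>a. SUP n. \<integral>\<^sup>+x. f a x * ennreal (g n x) \<partial>\<kappa> a) \<in> borel_measurable N"
    using part by measurable
  then show ?thesis by (rule measurable_cong[THEN iffD2, rotated]) (rule eq)
qed

section \<open>Factorial moments and independent thinning\<close>

text \<open>Tonelli for counting measures, transported along the bijection that appends the
  coordinate \<open>k\<close> to a tuple.\<close>

lemma nn_integral_count_space_PiE_Suc:
  assumes "countable S"
  shows "(\<integral>\<^sup>+x. u x \<partial>count_space (PiE {..<Suc k} (\<lambda>_. S))) =
    (\<integral>\<^sup>+x. \<integral>\<^sup>+y. u (x(k := y)) \<partial>count_space S \<partial>count_space (PiE {..<k} (\<lambda>_. S)))"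
proof -
  let ?A = "PiE {..<k} (\<lambda>_. S)"
  have cA: "countable ?A" using assms by (intro countable_PiE) auto
  have "inj_on (\<lambda>(x, y). x(k := y)) (?A \<times> S)" by (rule inj_combinator') simp
  moreover have "(\<lambda>(x, y). x(k := y)) ` (?A \<times> S) = PiE {..<Suc k} (\<lambda>_. S)"
    unfolding lessThan_Suc PiE_insert_eq by force
  ultimately have b: "bij_betw (\<lambda>(x, y). x(k := y)) (?A \<times> S) (PiE {..<Suc k} (\<lambda>_. S))"
    by (simp add: bij_betw_def)
  have "(\<integral>\<^sup>+x. u x \<partial>count_space (PiE {..<Suc k} (\<lambda>_. S))) =
      (\<integral>\<^sup>+z. u ((\<lambda>(x, y). x(k := y)) z) \<partial>(count_space ?A \<Otimes>\<^sub>M count_space S))"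
    unfolding pair_measure_countable[OF cA assms] by (rule nn_integral_bij_count_space[OF b, symmetric])
  also have "\<dots> = (\<integral>\<^sup>+x. \<integral>\<^sup>+y. u (x(k := y)) \<partial>count_space S \<partial>count_space ?A)"
    by (subst sigma_finite_measure.nn_integral_fst[symmetric])
      (auto simp: pair_measure_countable[OF cA assms] assms intro!: sigma_finite_measure_count_space_countable)
  finally show ?thesis .
qed

text \<open>Induction on the length: the sum over the last coordinate is an integral against the
  kernel, with the other coordinates as parameters. The integrand must be allowed to depend on
  \<open>a\<close>, since the partial sum \<open>h\<close> depends on \<open>a\<close> through
  \<open>\<kappa> a\<close> even when \<open>u\<close> does not.\<close>

lemma measurable_nn_integral_tuples:
  fixes k :: nat
  assumes D: "D \<in> sets borel" "D \<noteq> {}" and g: "exhaustion D g"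
    and \<kappa>[measurable]: "\<kappa> \<in> measurable N (conf_space D)"
    and u: "(\<lambda>(a, x). u a x) \<in> borel_measurable (N \<Otimes>\<^sub>M PiM {..<k} (\<lambda>_. restrict_space borel D))"
  shows "(\<lambda>a. \<integral>\<^sup>+x. u a x \<partial>count_space (PiE {..<k} (\<lambda>_. points (\<kappa> a)))) \<in> borel_measurable N"
  using u
proof (induction k arbitrary: u)
  \<comment> \<open>The only extensional tuple over the empty index set is
    \<open>\<lambda>_. undefined\<close>.\<close>
  case 0
  have "(\<integral>\<^sup>+x. u a x \<partial>count_space (PiE {..<0} (\<lambda>_. points (\<kappa> a)))) = u a (\<lambda>_. undefined)" for a
    by (simp add: nn_integral_count_space_finite)
  moreover have "(\<lambda>a. (\<lambda>(a, x). u a x) (a, \<lambda>_. undefined)) \<in> borel_measurable N"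
    by (rule measurable_compose[OF _ 0]) (auto intro!: measurable_Pair measurable_const simp: space_PiM)
  ultimately show ?case by simp
next
  case (Suc k)
  let ?R = "restrict_space borel D" and ?P = "PiM {..<k} (\<lambda>_. restrict_space borel D)"
  define h where "h a x = (\<integral>\<^sup>+y. u a (x(k := y)) \<partial>\<kappa> a)" for a x
  have [measurable]: "(\<lambda>z. (\<lambda>(x, y). x(k := y)) (snd (fst z), snd z)) \<in>
      measurable ((N \<Otimes>\<^sub>M ?P) \<Otimes>\<^sub>M ?R) (PiM {..<Suc k} (\<lambda>_. ?R))"
    unfolding lessThan_Suc by (rule measurable_compose[OF _ measurable_add_dim]) simp
  have um: "(\<lambda>z. u (fst (fst z)) ((snd (fst z))(k := snd z))) \<in> borel_measurable ((N \<Otimes>\<^sub>M ?P) \<Otimes>\<^sub>M ?R)"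
  proof -
    have "(\<lambda>z. (\<lambda>(a, x). u a x) (fst (fst z), (\<lambda>(x, y). x(k := y)) (snd (fst z), snd z)))
        \<in> borel_measurable ((N \<Otimes>\<^sub>M ?P) \<Otimes>\<^sub>M ?R)"
      by (rule measurable_compose[OF _ Suc.prems]) measurable
    then show ?thesis by simp
  qed
  have hm: "(\<lambda>(a, x). h a x) \<in> borel_measurable (N \<Otimes>\<^sub>M ?P)"
    unfolding h_def split_beta
    by (rule measurable_nn_integral_conf_kernel[OF D g, where \<kappa> = "\<lambda>z. \<kappa> (fst z)"
          and f = "\<lambda>z y. u (fst z) ((snd z)(k := y))"])
      (use um in \<open>auto simp: split_beta\<close>)
  have eq: "(\<integral>\<^sup>+x. u a x \<partial>count_space (PiE {..<Suc k} (\<lambda>_. points (\<kappa> a)))) =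
      (\<integral>\<^sup>+x. h a x \<partial>count_space (PiE {..<k} (\<lambda>_. points (\<kappa> a))))" if a: "a \<in> space N" for a
  proof -
    have c: "\<kappa> a \<in> conf D" using measurable_space[OF \<kappa> a] by simp
    have pD: "points (\<kappa> a) \<subseteq> D" using c by (auto elim: confE)
    show ?thesis
      unfolding nn_integral_count_space_PiE_Suc[OF countable_points_conf[OF g c]] h_def
    proof (intro nn_integral_cong)
      fix x assume "x \<in> space (count_space (PiE {..<k} (\<lambda>_. points (\<kappa> a))))"
      then have x: "x \<in> space ?P" using pD by (auto simp: space_PiM space_restrict_space PiE_iff)
      have "(\<lambda>y. u a (x(k := y))) \<in> borel_measurable ?R"
        using measurable_Pair2[OF um, of "(a, x)"] a x by (simp add: space_pair_measure)
      then show "(\<integral>\<^sup>+y. u a (x(k := y)) \<partial>count_space (points (\<kappa> a))) = (\<integral>\<^sup>+y. u a (x(k := y)) \<partial>\<kappa> a)"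
        by (rule nn_integral_conf[OF c, symmetric])
    qed
  qed
  from Suc.IH[OF hm] show ?case by (rule measurable_cong[THEN iffD2, rotated]) (rule eq)
qed

text \<open>Injectivity is a finite conjunction of conditions \<open>x i \<noteq> x j\<close>; each
  is measurable because the diagonal is, in a second countable Hausdorff space.\<close>

lemma measurable_inj_on_PiM:
  fixes D :: "'a::{second_countable_topology, t2_space} set" and k :: nat
  shows "(\<lambda>x. indicator {x. inj_on x {..<k}} x :: ennreal) \<in> borel_measurable (PiM {..<k} (\<lambda>_. restrict_space borel D))"
proof -
  let ?P = "PiM {..<k} (\<lambda>_. restrict_space borel D)"
  have c: "(\<lambda>x. x i) \<in> borel_measurable ?P" if "i \<in> {..<k}" for i
    using measurable_component_singleton[OF that, of "\<lambda>_. restrict_space borel D"]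
    by (simp add: measurable_restrict_space2_iff)
  have "{x \<in> space ?P. \<forall>i\<in>{..<k}. \<forall>j\<in>{..<k} - {i}. \<not> x i = x j} \<in> sets ?P"
    using c by (intro sets.sets_Collect_finite_All sets.sets_Collect_neg measurable_equality_set) auto
  moreover have "{x \<in> space ?P. inj_on x {..<k}} =
      {x \<in> space ?P. \<forall>i\<in>{..<k}. \<forall>j\<in>{..<k} - {i}. \<not> x i = x j}"
    by (auto simp: inj_on_def)
  ultimately have "{x \<in> space ?P. inj_on x {..<k}} \<in> sets ?P" by simp
  then have "(\<lambda>x. indicator {x \<in> space ?P. inj_on x {..<k}} x :: ennreal) \<in> borel_measurable ?P"
    by simp
  then show ?thesis by (rule measurable_cong[THEN iffD2, rotated]) (auto simp: indicator_def)
qed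

text \<open>Campbell's formula: the factorial moment identity, given for sets, extends to
  nonnegative integrands because both sides are additive, homogeneous and continuous along
  increasing sequences.\<close>

lemma nn_integral_factorial_moment:
  fixes D :: "'a::euclidean_space set" and k :: nat
  assumes D: "D \<in> sets borel" "D \<noteq> {}" and g: "exhaustion D g"
    and Z: "Z \<in> measurable \<Omega> (conf_space D)"
    and d: "d \<in> borel_measurable (PiM {..<k} (\<lambda>_. restrict_space lborel D))"
    and fm: "\<And>A. A \<in> sets (PiM {..<k} (\<lambda>_. restrict_space lborel D)) \<Longrightarrow>
       factorial_moment \<Omega> Z k A = (\<integral>\<^sup>+x\<in>A. d x \<partial>PiM {..<k} (\<lambda>_. restrict_space lborel D))"
    and u: "u \<in> borel_measurable (PiM {..<k} (\<lambda>_. restrict_space lborel D))"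
  shows "(\<integral>\<^sup>+\<omega>. \<integral>\<^sup>+x. u x * indicator {x. inj_on x {..<k}} x
        \<partial>count_space (PiE {..<k} (\<lambda>_. points (Z \<omega>))) \<partial>\<Omega>) =
    (\<integral>\<^sup>+x. u x * d x \<partial>PiM {..<k} (\<lambda>_. restrict_space lborel D))"
proof -
  let ?P = "PiM {..<k} (\<lambda>_. restrict_space lborel D)"
  let ?J = "indicator {x. inj_on x {..<k}} :: _ \<Rightarrow> ennreal"
  let ?C = "\<lambda>\<omega>. count_space (PiE {..<k} (\<lambda>_. points (Z \<omega>)))"
  \<comment> \<open>Integration uses \<open>lborel\<close> and the configuration space uses
    \<open>borel\<close>; the two product spaces have the same measurable sets.\<close>
  have sP: "sets ?P = sets (PiM {..<k} (\<lambda>_. restrict_space borel D))"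
    by (intro sets_PiM_cong) (auto simp: sets_restrict_space)
  have J[measurable]: "?J \<in> borel_measurable ?P"
    using measurable_inj_on_PiM[of k D] by (simp cong: measurable_cong_sets add: sP)
  have Zc: "Z \<omega> \<in> conf D" if "\<omega> \<in> space \<Omega>" for \<omega> using measurable_space[OF Z that] by simp
  have pD: "points (Z \<omega>) \<subseteq> D" if "\<omega> \<in> space \<Omega>" for \<omega> using Zc[OF that] by (auto elim: confE)
  have spP: "x \<in> space ?P" if "\<omega> \<in> space \<Omega>" "x \<in> PiE {..<k} (\<lambda>_. points (Z \<omega>))" for \<omega> x
    using that pD[OF that(1)] by (auto simp: space_PiM space_restrict_space PiE_iff)
  have meas: "(\<lambda>\<omega>. \<integral>\<^sup>+x. v x * ?J x \<partial>?C \<omega>) \<in> borel_measurable \<Omega>" if "v \<in> borel_measurable ?P" for v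
  proof (rule measurable_nn_integral_tuples[OF D g Z, where u = "\<lambda>_ x. v x * ?J x"])
    have "(\<lambda>x. v x * ?J x) \<in> borel_measurable ?P" using that by measurable
    then have "(\<lambda>x. v x * ?J x) \<in> borel_measurable (PiM {..<k} (\<lambda>_. restrict_space borel D))"
      by (simp cong: measurable_cong_sets add: sP)
    then show "(\<lambda>(a, x). v x * ?J x) \<in> borel_measurable (\<Omega> \<Otimes>\<^sub>M PiM {..<k} (\<lambda>_. restrict_space borel D))"
      by (rule measurable_compose[OF measurable_snd, THEN measurable_cong[THEN iffD2, rotated]]) auto
  qed
  show ?thesis
    using u
  proof (induct u)
    case (cong u v)
    have "(\<integral>\<^sup>+\<omega>. \<integral>\<^sup>+x. u x * ?J x \<partial>?C \<omega> \<partial>\<Omega>) = (\<integral>\<^sup>+\<omega>. \<integral>\<^sup>+x. v x * ?J x \<partial>?C \<omega> \<partial>\<Omega>)"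
      using cong(3) spP by (intro nn_integral_cong) simp
    moreover have "(\<integral>\<^sup>+x. u x * d x \<partial>?P) = (\<integral>\<^sup>+x. v x * d x \<partial>?P)"
      using cong(3) by (intro nn_integral_cong) simp
    ultimately show ?case using cong(4) by simp
  next
    case (set A)
    have "(\<integral>\<^sup>+x. indicator A x * ?J x \<partial>?C \<omega>) =
        emeasure (count_space UNIV) {x \<in> A. inj_on x {..<k} \<and> x ` {..<k} \<subseteq> points (Z \<omega>)}"
      if "\<omega> \<in> space \<Omega>" for \<omega>
    proof -
      let ?B = "{x \<in> A. inj_on x {..<k} \<and> x ` {..<k} \<subseteq> points (Z \<omega>)}"
      \<comment> \<open>Members of \<open>A\<close> are extensional, so counting them among all
        functions, as the factorial moment does, agrees with counting them in the set of extensional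
        tuples.\<close>
      have ext: "A \<subseteq> extensional {..<k}"
        using sets.sets_into_space[OF set] by (auto simp: space_PiM PiE_iff)
      then have B: "?B \<subseteq> PiE {..<k} (\<lambda>_. points (Z \<omega>))"
        using subsetD[OF ext] by (intro subsetI) (simp add: PiE_iff image_subset_iff)
      have "(\<integral>\<^sup>+x. indicator A x * ?J x \<partial>?C \<omega>) = (\<integral>\<^sup>+x. indicator ?B x \<partial>?C \<omega>)"
        by (intro nn_integral_cong) (auto simp: indicator_def PiE_iff)
      also have "\<dots> = emeasure (?C \<omega>) ?B" using B by (intro nn_integral_indicator) auto
      also have "\<dots> = emeasure (count_space UNIV) ?B" using B by (simp add: emeasure_count_space)
      finally show ?thesis .
    qed
    then have "(\<integral>\<^sup>+\<omega>. \<integral>\<^sup>+x. indicator A x * ?J x \<partial>?C \<omega> \<partial>\<Omega>) = factorial_moment \<Omega> Z k A"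
      unfolding factorial_moment_def by (intro nn_integral_cong)
    then show ?case unfolding fm[OF set] by (simp add: mult.commute)
  next
    case (mult u c)
    have "(\<integral>\<^sup>+\<omega>. \<integral>\<^sup>+x. c * u x * ?J x \<partial>?C \<omega> \<partial>\<Omega>) = c * (\<integral>\<^sup>+\<omega>. \<integral>\<^sup>+x. u x * ?J x \<partial>?C \<omega> \<partial>\<Omega>)"
      using meas[OF mult(2)] by (simp add: mult.assoc nn_integral_cmult)
    also have "\<dots> = (\<integral>\<^sup>+x. c * u x * d x \<partial>?P)"
      using mult(2) d unfolding mult(4) by (simp add: mult.assoc nn_integral_cmult)
    finally show ?case .
  next
    case (add u v)
    have "(\<integral>\<^sup>+\<omega>. \<integral>\<^sup>+x. (v x + u x) * ?J x \<partial>?C \<omega> \<partial>\<Omega>) =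
        (\<integral>\<^sup>+\<omega>. \<integral>\<^sup>+x. v x * ?J x \<partial>?C \<omega> \<partial>\<Omega>) + (\<integral>\<^sup>+\<omega>. \<integral>\<^sup>+x. u x * ?J x \<partial>?C \<omega> \<partial>\<Omega>)"
      using meas[OF add(1)] meas[OF add(4)] by (simp add: distrib_right nn_integral_add)
    also have "\<dots> = (\<integral>\<^sup>+x. (v x + u x) * d x \<partial>?P)"
      using add(1,4) d unfolding add(3,7) by (simp add: distrib_right nn_integral_add)
    finally show ?case .
  next
    case (seq U)
    have inc: "incseq (\<lambda>i x. U i x * c x)" for c :: "(nat \<Rightarrow> 'a) \<Rightarrow> ennreal"
      using seq(4) by (auto simp: incseq_def le_fun_def intro!: mult_right_mono)
    have sup: "(SUP i. U i) x * c = (SUP i. U i x * c)" for x c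
      by (simp add: SUP_mult_right_ennreal image_comp)
    have "(\<integral>\<^sup>+\<omega>. \<integral>\<^sup>+x. (SUP i. U i) x * ?J x \<partial>?C \<omega> \<partial>\<Omega>) =
        (\<integral>\<^sup>+\<omega>. (SUP i. \<integral>\<^sup>+x. U i x * ?J x \<partial>?C \<omega>) \<partial>\<Omega>)"
      unfolding sup by (subst nn_integral_monotone_convergence_SUP[OF inc]) auto
    also have "\<dots> = (SUP i. \<integral>\<^sup>+\<omega>. \<integral>\<^sup>+x. U i x * ?J x \<partial>?C \<omega> \<partial>\<Omega>)"
    proof (rule nn_integral_monotone_convergence_SUP)
      show "incseq (\<lambda>i \<omega>. \<integral>\<^sup>+x. U i x * ?J x \<partial>?C \<omega>)"
        using inc[of ?J] by (auto simp: incseq_def le_fun_def intro!: nn_integral_mono)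
    qed (rule meas[OF seq(1)])
    also have "\<dots> = (SUP i. \<integral>\<^sup>+x. U i x * d x \<partial>?P)" unfolding seq(3) ..
    also have "\<dots> = (\<integral>\<^sup>+x. (SUP i. U i) x * d x \<partial>?P)"
      unfolding sup using seq(1) d by (subst nn_integral_monotone_convergence_SUP[OF inc]) auto
    finally show ?case .
  qed
qed

text \<open>A tuple survives when all of its coins show \<open>True\<close>. After exchanging the
  sum over tuples with the average over coins, independence yields the product of the retention
  probabilities. Distinctness matters: a repeated point has only one coin.\<close>

lemma nn_integral_bernoulli_thinning_tuples:
  fixes k :: nat
  assumes S: "countable S" and p: "\<And>z. z \<in> S \<Longrightarrow> 0 \<le> p z \<and> p z \<le> 1"
  shows "(\<integral>\<^sup>+b. \<integral>\<^sup>+x. v x * indicator {x. inj_on x {..<k}} x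
        \<partial>count_space (PiE {..<k} (\<lambda>_. {z \<in> S. b z})) \<partial>PiM S (\<lambda>z. measure_pmf (bernoulli_pmf (p z)))) =
    (\<integral>\<^sup>+x. v x * (\<Prod>i<k. ennreal (p (x i))) * indicator {x. inj_on x {..<k}} x
        \<partial>count_space (PiE {..<k} (\<lambda>_. S)))"
proof -
  interpret product_prob_space "\<lambda>z. measure_pmf (bernoulli_pmf (p z))" S
    by standard
  let ?B = "PiM S (\<lambda>z. measure_pmf (bernoulli_pmf (p z)))"
  let ?J = "indicator {x. inj_on x {..<k}} :: _ \<Rightarrow> ennreal"
  let ?T = "PiE {..<k} (\<lambda>_. S)"
  have cT: "countable ?T" using S by (intro countable_PiE) auto
  \<comment> \<open>Conditioning on the image of the tuple gives the event the shape of a finite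
    cylinder, to which the product formula applies; injectivity later turns the product over the
    image into one over the indices.\<close>
  define E where "E x = {b \<in> space ?B. \<forall>z\<in>x ` {..<k}. b z \<in> {True}}" for x
  have "{b \<in> space ?B. b z \<in> {True}} \<in> sets ?B" if "z \<in> S" for z
  proof -
    have "(\<lambda>b. b z) -` {True} \<inter> space ?B \<in> sets ?B"
      using measurable_component_singleton[OF that] by (rule measurable_sets) simp
    moreover have "(\<lambda>b. b z) -` {True} \<inter> space ?B = {b \<in> space ?B. b z \<in> {True}}" by auto
    ultimately show ?thesis by simp
  qed
  then have E[measurable]: "E x \<in> sets ?B" if "x \<in> ?T" for x
    unfolding E_def using that by (intro sets.sets_Collect_finite_All) (auto simp: PiE_iff)
  have "(\<integral>\<^sup>+x. v x * ?J x \<partial>count_space (PiE {..<k} (\<lambda>_. {z \<in> S. b z}))) =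
      (\<integral>\<^sup>+x. v x * ?J x * indicator (E x) b \<partial>count_space ?T)" if "b \<in> space ?B" for b
  proof -
    have "indicator (PiE {..<k} (\<lambda>_. {z \<in> S. b z})) x = (indicator (E x) b * indicator ?T x :: ennreal)" for x
      using that by (auto simp: E_def indicator_def PiE_iff)
    then show ?thesis by (simp add: nn_integral_count_space_indicator mult.assoc)
  qed
  then have "(\<integral>\<^sup>+b. \<integral>\<^sup>+x. v x * ?J x \<partial>count_space (PiE {..<k} (\<lambda>_. {z \<in> S. b z})) \<partial>?B) =
      (\<integral>\<^sup>+b. \<integral>\<^sup>+x. v x * ?J x * indicator (E x) b \<partial>count_space ?T \<partial>?B)"
    by (rule nn_integral_cong)
  also have "\<dots> = (\<integral>\<^sup>+x. \<integral>\<^sup>+b. v x * ?J x * indicator (E x) b \<partial>?B \<partial>count_space ?T)"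
    by (rule nn_integral_count_space_nn_integral[OF cT]) measurable
  also have "\<dots> = (\<integral>\<^sup>+x. v x * (\<Prod>i<k. ennreal (p (x i))) * ?J x \<partial>count_space ?T)"
  proof (intro nn_integral_cong)
    fix x assume "x \<in> space (count_space ?T)"
    then have x: "x \<in> ?T" by simp
    have "(\<integral>\<^sup>+b. v x * ?J x * indicator (E x) b \<partial>?B) = v x * ?J x * emeasure ?B (E x)"
      using E[OF x] by (simp add: nn_integral_cmult)
    also have "\<dots> = v x * (\<Prod>i<k. ennreal (p (x i))) * ?J x"
    proof (cases "inj_on x {..<k}")
      case True
      have "emeasure ?B (E x) = (\<Prod>z\<in>x ` {..<k}. emeasure (measure_pmf (bernoulli_pmf (p z))) {True})"
        unfolding E_def using x by (intro emeasure_PiM_Collect) (auto simp: PiE_iff)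
      also have "\<dots> = (\<Prod>i<k. emeasure (measure_pmf (bernoulli_pmf (p (x i)))) {True})"
        using True by (simp add: prod.reindex)
      also have "\<dots> = (\<Prod>i<k. ennreal (p (x i)))"
        using x p by (intro prod.cong) (auto simp: PiE_iff emeasure_pmf_single)
      finally show ?thesis by (simp add: ac_simps)
    qed simp
    finally show "(\<integral>\<^sup>+b. v x * ?J x * indicator (E x) b \<partial>?B) = v x * (\<Prod>i<k. ennreal (p (x i))) * ?J x" .
  qed
  finally show ?thesis .
qed

text \<open>Conditionally on \<open>Z\<close> the coins contribute the factor of the previous lemma;
  Campbell's formula for \<open>Z\<close> is then applied to the weighted integrand.\<close>

lemma nn_integral_thinning_factorial_moment:
  fixes D :: "'a::euclidean_space set" and k :: nat
  assumes D: "D \<in> sets borel" "D \<noteq> {}" and g: "exhaustion D g"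
    and Z: "Z \<in> measurable \<Omega> (conf_space D)"
    and d: "d \<in> borel_measurable (PiM {..<k} (\<lambda>_. restrict_space lborel D))"
    and fm: "\<And>A. A \<in> sets (PiM {..<k} (\<lambda>_. restrict_space lborel D)) \<Longrightarrow>
       factorial_moment \<Omega> Z k A = (\<integral>\<^sup>+x\<in>A. d x \<partial>PiM {..<k} (\<lambda>_. restrict_space lborel D))"
    and th: "independent_thinning \<Omega> Z M D p"
    and p: "\<And>z. z \<in> D \<Longrightarrow> 0 \<le> p z \<and> p z \<le> 1" and pm: "p \<in> borel_measurable (restrict_space borel D)"
    and u: "u \<in> borel_measurable (PiM {..<k} (\<lambda>_. restrict_space lborel D))"
  shows "(\<integral>\<^sup>+\<omega>. \<integral>\<^sup>+x. u x * indicator {x. inj_on x {..<k}} x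
        \<partial>count_space (PiE {..<k} (\<lambda>_. points (M \<omega>))) \<partial>\<Omega>) =
    (\<integral>\<^sup>+x. u x * (\<Prod>i<k. ennreal (p (x i))) * d x \<partial>PiM {..<k} (\<lambda>_. restrict_space lborel D))"
proof -
  let ?P = "PiM {..<k} (\<lambda>_. restrict_space lborel D)" and ?Q = "PiM {..<k} (\<lambda>_. restrict_space borel D)"
  let ?J = "indicator {x. inj_on x {..<k}} :: _ \<Rightarrow> ennreal"
  have sP: "sets ?P = sets ?Q"
    by (intro sets_PiM_cong) (auto simp: sets_restrict_space)
  \<comment> \<open>The functional ignores the original configuration and sums over tuples of the
    thinned one, so the joint-law identity reduces to a statement about \<open>M\<close>.\<close>
  define f where "f z = (\<integral>\<^sup>+x. u x * ?J x \<partial>count_space (PiE {..<k} (\<lambda>_. points (snd z))))"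
    for z :: "'a measure \<times> 'a measure"
  have "f \<in> borel_measurable (conf_space D \<Otimes>\<^sub>M conf_space D)"
    unfolding f_def
  proof (rule measurable_nn_integral_tuples[OF D g measurable_snd, where u = "\<lambda>_ x. u x * ?J x"])
    have "u \<in> borel_measurable ?Q" using u by (simp cong: measurable_cong_sets add: sP)
    then have "(\<lambda>x. u x * ?J x) \<in> borel_measurable ?Q" using measurable_inj_on_PiM[of k D] by measurable
    then show "(\<lambda>(a, x). u x * ?J x) \<in> borel_measurable ((conf_space D \<Otimes>\<^sub>M conf_space D) \<Otimes>\<^sub>M ?Q)"
      by (rule measurable_compose[OF measurable_snd, THEN measurable_cong[THEN iffD2, rotated]]) auto
  qed
  then have "(\<integral>\<^sup>+\<omega>. f (Z \<omega>, M \<omega>) \<partial>\<Omega>) = (\<integral>\<^sup>+\<omega>. (\<integral>\<^sup>+b. f (Z \<omega>, counting_measure_of D {z \<in> points (Z \<omega>). b z})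
           \<partial>(\<Pi>\<^sub>M z\<in>points (Z \<omega>). measure_pmf (bernoulli_pmf (p z)))) \<partial>\<Omega>)"
    using th unfolding independent_thinning_def by blast
  also have "\<dots> = (\<integral>\<^sup>+\<omega>. \<integral>\<^sup>+x. u x * (\<Prod>i<k. ennreal (p (x i))) * ?J x
        \<partial>count_space (PiE {..<k} (\<lambda>_. points (Z \<omega>))) \<partial>\<Omega>)"
  proof (intro nn_integral_cong)
    fix \<omega> assume "\<omega> \<in> space \<Omega>"
    then have c: "Z \<omega> \<in> conf D" using measurable_space[OF Z] by simp
    then have pD: "points (Z \<omega>) \<subseteq> D" by (auto elim: confE)
    then have "points (counting_measure_of D {z \<in> points (Z \<omega>). b z}) = {z \<in> points (Z \<omega>). b z}" for b
      by (intro points_counting_measure_of) auto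
    then show "(\<integral>\<^sup>+b. f (Z \<omega>, counting_measure_of D {z \<in> points (Z \<omega>). b z})
           \<partial>(\<Pi>\<^sub>M z\<in>points (Z \<omega>). measure_pmf (bernoulli_pmf (p z)))) =
        (\<integral>\<^sup>+x. u x * (\<Prod>i<k. ennreal (p (x i))) * ?J x \<partial>count_space (PiE {..<k} (\<lambda>_. points (Z \<omega>))))"
      unfolding f_def using countable_points_conf[OF g c] p pD
      by (simp only: snd_conv) (rule nn_integral_bernoulli_thinning_tuples, auto)
  qed
  also have "\<dots> = (\<integral>\<^sup>+x. u x * (\<Prod>i<k. ennreal (p (x i))) * d x \<partial>?P)"
  proof (rule nn_integral_factorial_moment[OF D g Z d fm])
    have "(\<lambda>x. p (x i)) \<in> borel_measurable ?Q" if "i \<in> {..<k}" for i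
      by (rule measurable_compose[OF measurable_component_singleton[OF that] pm])
    then have [measurable]: "(\<lambda>x. p (x i)) \<in> borel_measurable ?P" if "i \<in> {..<k}" for i
      using that by (simp cong: measurable_cong_sets add: sP)
    show "(\<lambda>x. u x * (\<Prod>i<k. ennreal (p (x i)))) \<in> borel_measurable ?P"
      using u by measurable
  qed
  finally show ?thesis by (simp add: f_def)
qed

section \<open>The first positive point under the reduced Palm distribution\<close>

lemma exhaustion_real: "exhaustion (UNIV :: real set) (\<lambda>n x. max 0 (min 1 (real n - \<bar>x\<bar>)))"
  unfolding exhaustion_def
proof (intro conjI allI)
  fix n :: nat
  show "continuous_on UNIV (\<lambda>x :: real. max 0 (min 1 (real n - \<bar>x\<bar>)))" by (intro continuous_intros)
  show "\<exists>K\<subseteq>UNIV. compact K \<and> (\<forall>x :: real. x \<notin> K \<longrightarrow> max 0 (min 1 (real n - \<bar>x\<bar>)) = 0)"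
    by (rule exI[of _ "{- real n..real n}"]) auto
  fix x :: real
  show "0 \<le> max 0 (min 1 (real n - \<bar>x\<bar>))" by simp
next
  show "incseq (\<lambda>n x :: real. max 0 (min 1 (real n - \<bar>x\<bar>)))"
    by (auto simp: incseq_def le_fun_def)
next
  fix x :: real
  obtain n where n: "\<bar>x\<bar> + 1 < real n" using reals_Archimedean2 by blast
  have "1 \<le> (SUP n. ennreal (max 0 (min 1 (real n - \<bar>x\<bar>))))"
    by (rule SUP_upper2[of n]) (use n in auto)
  moreover have "(SUP n. ennreal (max 0 (min 1 (real n - \<bar>x\<bar>)))) \<le> 1"
    by (intro SUP_least) auto
  ultimately show "(SUP n. ennreal (max 0 (min 1 (real n - \<bar>x\<bar>)))) = indicator UNIV x" by auto
qed

text \<open>Two ramps are multiplied: one confines the norm to at most \<open>n\<close>, the other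
  keeps the height above \<open>1 / n\<close>, since compact subsets of the open half-plane stay
  away from the real axis.\<close>

lemma exhaustion_upper_half_plane:
  "exhaustion upper_half_plane
     (\<lambda>n z. max 0 (min 1 (real n - norm z)) * max 0 (min 1 (real n * Im z - 1)))"
  (is "exhaustion _ ?g")
  unfolding exhaustion_def
proof (intro conjI allI)
  fix n :: nat
  show "continuous_on UNIV (?g n)" by (intro continuous_intros)
  have "compact (cball (0 :: complex) (real n) \<inter> {z. 1 \<le> real n * Im z})"
    by (intro compact_Int_closed compact_cball closed_Collect_le continuous_intros)
  moreover have "cball (0 :: complex) (real n) \<inter> {z. 1 \<le> real n * Im z} \<subseteq> upper_half_plane"
    unfolding upper_half_plane_def
    by (smt (verit) Int_iff mem_Collect_eq of_nat_0_le_iff subsetI zero_less_mult_pos mult_nonneg_nonpos)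
  ultimately show "\<exists>K\<subseteq>upper_half_plane. compact K \<and> (\<forall>z. z \<notin> K \<longrightarrow> ?g n z = 0)"
    by (intro exI[of _ "cball 0 (real n) \<inter> {z. 1 \<le> real n * Im z}"]) auto
  fix z
  show "0 \<le> ?g n z" by simp
next
  show "incseq ?g"
    unfolding incseq_def le_fun_def
  proof (intro allI impI)
    fix m n :: nat and z assume mn: "m \<le> n"
    show "?g m z \<le> ?g n z"
    proof (cases "0 \<le> Im z")
      case True
      then have "real m * Im z \<le> real n * Im z" using mn by (intro mult_right_mono) auto
      then show ?thesis using mn by (intro mult_mono) auto
    next
      \<comment> \<open>Below the axis \<open>real n * Im z\<close> decreases with \<open>n\<close>,
        but the height factor is zero there.\<close>
      case False
      then have "real m * Im z \<le> 0" by (simp add: mult_nonneg_nonpos)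
      then have "?g m z = 0" by (simp add: max_def)
      moreover have "0 \<le> ?g n z" by simp
      ultimately show ?thesis by linarith
    qed
  qed
next
  fix z :: complex
  show "(SUP n. ennreal (?g n z)) = indicator upper_half_plane z"
  proof (cases "Im z > 0")
    case True
    obtain n1 where n1: "norm z + 1 < real n1" using reals_Archimedean2 by blast
    obtain n2 where n2: "2 < real n2 * Im z" using reals_Archimedean3[OF True] by blast
    define n where "n = max n1 n2"
    have "real n2 * Im z \<le> real n * Im z" using True by (intro mult_right_mono) (auto simp: n_def)
    moreover have "real n1 \<le> real n" by (simp add: n_def)
    ultimately have "?g n z = 1" using n1 n2 by simp
    then have "1 \<le> (SUP n. ennreal (?g n z))" by (intro SUP_upper2[of n]) auto
    moreover have "(SUP n. ennreal (?g n z)) \<le> 1"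
      by (intro SUP_least) (auto intro: mult_le_one)
    ultimately show ?thesis using True by (auto simp: upper_half_plane_def)
  next
    case False
    have g0: "?g n z = 0" for n
    proof -
      have "real n * Im z \<le> 0" using False by (simp add: mult_nonneg_nonpos)
      then have "max 0 (min 1 (real n * Im z - 1)) = 0" by simp
      then show ?thesis by simp
    qed
    show ?thesis unfolding g0 using False by (simp add: upper_half_plane_def)
  qed
qed

section \<open>Atoms, support and the reduced configuration\<close>

lemma emeasure_conf:
  fixes \<mu> :: "'a::t1_space measure"
  assumes "\<mu> \<in> conf D" "A \<in> sets (restrict_space borel D)"
  shows "emeasure \<mu> A = emeasure (count_space (points \<mu>)) (points \<mu> \<inter> A)"
  using assms(1) by (rule confE) (metis assms(2) emeasure_counting_measure_of)

lemma emeasure_conf_eq_0_iff: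
  fixes \<mu> :: "'a::t1_space measure"
  assumes "\<mu> \<in> conf D" "A \<in> sets (restrict_space borel D)"
  shows "emeasure \<mu> A = 0 \<longleftrightarrow> points \<mu> \<inter> A = {}"
  unfolding emeasure_conf[OF assms] by (subst emeasure_count_space_eq_0) auto

text \<open>By local finiteness only finitely many other atoms lie near \<open>x\<close>. Removing
  them from a ball leaves an open neighbourhood of \<open>x\<close>, which has mass zero unless
  \<open>x\<close> itself is an atom.\<close>

lemma supp_conf:
  fixes \<mu> :: "real measure"
  assumes \<mu>: "\<mu> \<in> conf UNIV"
  shows "supp \<mu> = points \<mu>"
proof (intro equalityI subsetI)
  fix x assume x: "x \<in> supp \<mu>"
  have fin: "finite (points \<mu> \<inter> cball x 1 - {x})"
    using \<mu> by (auto elim!: confE)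
  then have op: "open (ball x 1 - (points \<mu> \<inter> cball x 1 - {x}))"
    by (intro open_Diff open_ball finite_imp_closed)
  show "x \<in> points \<mu>"
  proof (rule ccontr)
    assume "x \<notin> points \<mu>"
    then have "points \<mu> \<inter> (ball x 1 - (points \<mu> \<inter> cball x 1 - {x})) = {}" by auto
    then have "emeasure \<mu> (ball x 1 - (points \<mu> \<inter> cball x 1 - {x})) = 0"
      using op by (subst emeasure_conf_eq_0_iff[OF \<mu>]) (auto simp: sets_restrict_space)
    then show False using x op by (auto simp: supp_def)
  qed
next
  fix x assume x: "x \<in> points \<mu>"
  show "x \<in> supp \<mu>"
    unfolding supp_def
  proof (intro CollectI allI impI)
    fix U assume U: "open U \<and> x \<in> U"
    then show "emeasure \<mu> U \<noteq> 0"
      using x by (subst emeasure_conf_eq_0_iff[OF \<mu>]) (auto simp: sets_restrict_space)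
  qed
qed

text \<open>Local finiteness excludes points that approach \<open>t\<close> from the right without
  reaching it, so an infimum at most \<open>t\<close> requires a point in \<open>{0<..t}\<close>.
  The right-hand side is a measurable condition on \<open>\<mu>\<close>.\<close>

lemma first_positive_point_le_iff:
  assumes \<mu>: "\<mu> \<in> conf UNIV"
  shows "first_positive_point \<mu> \<le> ereal t \<longleftrightarrow> emeasure \<mu> {0<..t} \<noteq> 0"
proof -
  have "first_positive_point \<mu> \<le> ereal t \<longleftrightarrow> points \<mu> \<inter> {0<..t} \<noteq> {}"
  proof
    assume "points \<mu> \<inter> {0<..t} \<noteq> {}"
    then obtain x where "x \<in> points \<mu>" "0 < x" "x \<le> t" by auto
    then show "first_positive_point \<mu> \<le> ereal t"
      unfolding first_positive_point_def supp_conf[OF \<mu>] by (intro Inf_lower2[of "ereal x"]) auto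
  next
    assume le: "first_positive_point \<mu> \<le> ereal t"
    show "points \<mu> \<inter> {0<..t} \<noteq> {}"
    proof
      assume empty: "points \<mu> \<inter> {0<..t} = {}"
      \<comment> \<open>The artificial element \<open>t + 1\<close> keeps the set nonempty, so that
        its minimum exists; this minimum exceeds \<open>t\<close> and lies below every positive
        point.\<close>
      define F where "F = insert (t + 1) (points \<mu> \<inter> {t<..t + 1})"
      have "finite (points \<mu> \<inter> {t..t + 1})" using \<mu> by (auto elim!: confE)
      then have fin: "finite F" unfolding F_def
        by (intro finite.insertI) (erule rev_finite_subset, auto)
      have "Min F > t" using fin by (subst Min_gr_iff) (auto simp: F_def)
      moreover have "ereal (Min F) \<le> first_positive_point \<mu>"
        unfolding first_positive_point_def supp_conf[OF \<mu>]
      proof (intro Inf_greatest)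
        fix y assume "y \<in> ereal ` (points \<mu> \<inter> {0<..})"
        then obtain x where x: "y = ereal x" "x \<in> points \<mu>" "x > 0" by auto
        then have "t < x" using empty by force
        have "Min F \<le> x"
        proof (cases "x \<le> t + 1")
          case True
          then show ?thesis using fin x \<open>t < x\<close> by (intro Min_le) (auto simp: F_def)
        next
          case False
          have "Min F \<le> t + 1" using fin by (intro Min_le) (auto simp: F_def)
          then show ?thesis using False by simp
        qed
        then show "ereal (Min F) \<le> y" using x by simp
      qed
      ultimately show False using le by (metis ereal_less_eq(3) leD order.trans)
    qed
  qed
  then show ?thesis
    by (subst emeasure_conf_eq_0_iff[OF \<mu>]) (auto simp: sets_restrict_space)
qed

text \<open>The point \<open>x\<close> carries mass exactly one, so the subtraction is never
  truncated: it cancels a finite summand on every set.\<close>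

lemma diff_measure_conf_return:
  fixes \<mu> :: "real measure"
  assumes \<mu>: "\<mu> \<in> conf UNIV" and x: "x \<in> points \<mu>"
  shows "diff_measure \<mu> (return borel x) = counting_measure_of UNIV (points \<mu> - {x})"
proof -
  let ?\<nu> = "counting_measure_of UNIV (points \<mu> - {x})"
  have sets: "sets \<mu> = sets borel" using \<mu> by simp
  have diff: "emeasure \<mu> A - emeasure (return borel x) A = emeasure ?\<nu> A" if A: "A \<in> sets borel" for A
  proof -
    have A': "A \<in> sets (restrict_space borel UNIV)" using A by simp
    have "emeasure \<mu> A = emeasure ?\<nu> A + indicator A x"
    proof (cases "x \<in> A")
      case True
      then have "points \<mu> \<inter> A = insert x ((points \<mu> - {x}) \<inter> A)" using x by auto
      then show ?thesis
        unfolding emeasure_conf[OF \<mu> A'] emeasure_counting_measure_of[OF subset_UNIV A']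
        using True x by (subst (1 2) emeasure_count_space) auto
    next
      case False
      then have "points \<mu> \<inter> A = (points \<mu> - {x}) \<inter> A" by auto
      then show ?thesis
        unfolding emeasure_conf[OF \<mu> A'] emeasure_counting_measure_of[OF subset_UNIV A']
        using False by (subst (1 2) emeasure_count_space) auto
    qed
    then show ?thesis using A by (simp add: indicator_def)
  qed
  \<comment> \<open>A configuration may have infinite total mass. The comparison therefore unfolds
    \<open>measure_of\<close>, which depends only on the values on measurable sets.\<close>
  have "measure_of (space \<mu>) (sets \<mu>) (\<lambda>A. emeasure \<mu> A - emeasure (return borel x) A) =
      measure_of (space \<mu>) (sets \<mu>) (emeasure ?\<nu>)"
  proof (intro measure_of_eq sets.space_closed)
    fix A assume "A \<in> sigma_sets (space \<mu>) (sets \<mu>)"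
    then have "A \<in> sets borel" unfolding sets.sigma_sets_eq using sets by simp
    then show "emeasure \<mu> A - emeasure (return borel x) A = emeasure ?\<nu> A" by (rule diff)
  qed
  also have "\<dots> = measure_of (space ?\<nu>) (sets ?\<nu>) (emeasure ?\<nu>)"
    using \<mu> by simp
  also have "\<dots> = ?\<nu>" by (rule measure_of_of_measure)
  finally show ?thesis unfolding diff_measure_def .
qed

text \<open>The interval is open on the left, hence the removal of \<open>x\<close> does not affect
  its right neighbours.\<close>

lemma emeasure_shift_reduced:
  assumes \<mu>: "\<mu> \<in> conf UNIV" and x: "x \<in> points \<mu>"
  shows "emeasure (shift x (diff_measure \<mu> (return borel x))) {0<..t} \<noteq> 0 \<longleftrightarrow> emeasure \<mu> {x<..x + t} \<noteq> 0"
proof -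
  have "(\<lambda>y. y - x) \<in> measurable (counting_measure_of UNIV (points \<mu> - {x})) borel"
    by (simp cong: measurable_cong_sets)
  then have "emeasure (shift x (diff_measure \<mu> (return borel x))) {0<..t} =
      emeasure (counting_measure_of UNIV (points \<mu> - {x})) ((\<lambda>y. y - x) -` {0<..t})"
    unfolding shift_def diff_measure_conf_return[OF assms] by (subst emeasure_distr) auto
  also have "(\<lambda>y. y - x) -` {0<..t} = {x<..x + t}" by auto
  also have "emeasure (counting_measure_of UNIV (points \<mu> - {x})) {x<..x + t} =
      emeasure (count_space (points \<mu> - {x})) ((points \<mu> - {x}) \<inter> {x<..x + t})"
    by (rule emeasure_counting_measure_of) auto
  also have "\<dots> \<noteq> 0 \<longleftrightarrow> points \<mu> \<inter> {x<..x + t} \<noteq> {}"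
    by (subst emeasure_count_space_eq_0) auto
  also have "\<dots> \<longleftrightarrow> emeasure \<mu> {x<..x + t} \<noteq> 0"
    by (subst emeasure_conf_eq_0_iff[OF \<mu>]) auto
  finally show ?thesis .
qed

text \<open>Written as an integral against \<open>\<mu>\<close> rather than a sum over its atoms, so
  that it also makes sense, with multiplicities, for the projection of an arbitrary half-plane
  configuration.\<close>

definition close_points :: "real \<Rightarrow> real measure \<Rightarrow> ennreal" where
  "close_points t \<mu> = (\<integral>\<^sup>+x. indicator {0..1} x * of_bool (emeasure \<mu> {x<..x + t} \<noteq> 0) \<partial>\<mu>)"

text \<open>The interval moves with \<open>x\<close>, so joint measurability is required. It comes
  from the kernel lemma with the pair of configuration and position as parameter.\<close>

lemma measurable_emeasure_interval:
  "(\<lambda>(\<mu>, x). emeasure \<mu> {x<..x + t}) \<in> borel_measurable (conf_space UNIV \<Otimes>\<^sub>M (borel :: real measure))"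
proof -
  let ?f = "\<lambda>z y. indicator {0<..t} (y - snd z) :: ennreal"
  have "(\<lambda>z. \<integral>\<^sup>+y. ?f z y \<partial>fst z) \<in> borel_measurable (conf_space UNIV \<Otimes>\<^sub>M (borel :: real measure))"
    by (rule measurable_nn_integral_conf_kernel[OF _ _ exhaustion_real]) auto
  then show ?thesis
  proof (rule measurable_cong[THEN iffD2, rotated])
    fix z :: "real measure \<times> real" assume "z \<in> space (conf_space UNIV \<Otimes>\<^sub>M borel)"
    then have s: "sets (fst z) = sets borel" by (auto simp: space_pair_measure)
    have "(\<integral>\<^sup>+y. ?f z y \<partial>fst z) = (\<integral>\<^sup>+y. indicator {snd z<..snd z + t} y \<partial>fst z)"
      by (intro nn_integral_cong) (auto simp: indicator_def)
    then show "(case z of (\<mu>, x) \<Rightarrow> emeasure \<mu> {x<..x + t}) = (\<integral>\<^sup>+y. ?f z y \<partial>fst z)"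
      using s by (simp add: split_beta)
  qed
qed

lemma measurable_close_points: "close_points t \<in> borel_measurable (conf_space UNIV)"
  unfolding close_points_def
proof (rule measurable_nn_integral_conf_kernel[OF _ _ exhaustion_real])
  have [measurable]: "(\<lambda>z. emeasure (fst z) {snd z<..snd z + t}) \<in> borel_measurable (conf_space UNIV \<Otimes>\<^sub>M borel)"
    using measurable_emeasure_interval by (simp add: split_beta)
  have "(\<lambda>z. indicator {0..1} (snd z) * of_bool (emeasure (fst z) {snd z<..snd z + t} \<noteq> 0) :: ennreal)
      \<in> borel_measurable (conf_space UNIV \<Otimes>\<^sub>M borel)"
    by measurable
  then show "(\<lambda>(\<mu>, x). indicator {0..1} x * of_bool (emeasure \<mu> {x<..x + t} \<noteq> 0) :: ennreal)
      \<in> borel_measurable (conf_space UNIV \<Otimes>\<^sub>M restrict_space borel UNIV)"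
    by (simp add: split_beta)
qed auto

lemma reduced_palm_first_positive_point:
  assumes X: "X \<in> measurable \<Omega> (conf_space UNIV)" and P: "reduced_palm \<Omega> X l P"
  shows "l * measure P {\<mu> \<in> space P. first_positive_point \<mu> \<le> ereal t} =
    enn2real (\<integral>\<^sup>+\<omega>. close_points t (X \<omega>) \<partial>\<Omega>)"
proof -
  define F :: "real measure \<Rightarrow> real" where "F \<mu> = of_bool (emeasure \<mu> {0<..t} \<noteq> 0)" for \<mu>
  have sP: "sets P = sets (conf_space UNIV)" "prob_space P" using P by (auto simp: reduced_palm_def)
  have spP: "space P = conf UNIV" using sets_eq_imp_space_eq[OF sP(1)] by simp
  have "(\<lambda>\<mu>. (case (\<mu>, 0) of (\<mu>, x) \<Rightarrow> emeasure \<mu> {x<..x + t})) \<in> borel_measurable (conf_space UNIV)"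
    by (rule measurable_compose[OF _ measurable_emeasure_interval]) auto
  then have [measurable]: "(\<lambda>\<mu>. emeasure \<mu> {0<..t}) \<in> borel_measurable (conf_space UNIV)" by simp
  have F: "F \<in> borel_measurable (conf_space UNIV)" unfolding F_def by measurable
  have "F ` conf UNIV \<subseteq> {0, 1}" by (auto simp: F_def)
  then have "bounded (F ` conf UNIV)" by (rule bounded_subset[rotated]) (auto simp: finite_imp_bounded)
  then have "(\<integral>\<omega>. (\<Sum>x\<in>points (X \<omega>) \<inter> {0..1}. F (shift x (diff_measure (X \<omega>) (return borel x)))) \<partial>\<Omega>) =
      measure lborel {0..1 :: real} * l * (\<integral>\<mu>. F \<mu> \<partial>P)"
    using P F unfolding reduced_palm_def by (elim conjE allE[of _ "{0..1}"] allE[of _ F]) auto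
  moreover have "(\<integral>\<mu>. F \<mu> \<partial>P) = measure P {\<mu> \<in> space P. first_positive_point \<mu> \<le> ereal t}"
  proof -
    let ?A = "{\<mu> \<in> space P. first_positive_point \<mu> \<le> ereal t}"
    have eq: "?A = {\<mu> \<in> space (conf_space UNIV). emeasure \<mu> {0<..t} \<noteq> 0}"
      by (auto simp: spP first_positive_point_le_iff)
    have "?A \<in> sets P" unfolding sP(1) eq by measurable
    then have "measure P ?A = (\<integral>\<mu>. indicator ?A \<mu> \<partial>P)" by simp
    also have "\<dots> = (\<integral>\<mu>. F \<mu> \<partial>P)"
      by (intro Bochner_Integration.integral_cong) (auto simp: F_def spP first_positive_point_le_iff)
    finally show ?thesis ..
  qed
  moreover have "(\<integral>\<omega>. (\<Sum>x\<in>points (X \<omega>) \<inter> {0..1}. F (shift x (diff_measure (X \<omega>) (return borel x)))) \<partial>\<Omega>) =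
      enn2real (\<integral>\<^sup>+\<omega>. close_points t (X \<omega>) \<partial>\<Omega>)"
  proof -
    have eq: "(\<Sum>x\<in>points (X \<omega>) \<inter> {0..1}. F (shift x (diff_measure (X \<omega>) (return borel x)))) =
        enn2real (close_points t (X \<omega>))" "close_points t (X \<omega>) < \<top>" if "\<omega> \<in> space \<Omega>" for \<omega>
    proof -
      have \<mu>: "X \<omega> \<in> conf UNIV" using measurable_space[OF X that] by simp
      have fin: "finite (points (X \<omega>) \<inter> {0..1})" using \<mu> by (auto elim!: confE)
      have m: "(\<lambda>x. emeasure (X \<omega>) {x<..x + t}) \<in> borel_measurable borel"
        using measurable_Pair2[OF measurable_emeasure_interval, of "X \<omega>"] \<mu> by simp
      have "close_points t (X \<omega>) =
          (\<integral>\<^sup>+x. indicator {0..1} x * of_bool (emeasure (X \<omega>) {x<..x + t} \<noteq> 0) \<partial>count_space (points (X \<omega>)))"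
        unfolding close_points_def using m by (intro nn_integral_conf[OF \<mu>]) simp
      also have "\<dots> = (\<Sum>x\<in>points (X \<omega>) \<inter> {0..1}.
          indicator {0..1} x * of_bool (emeasure (X \<omega>) {x<..x + t} \<noteq> 0))"
        using fin by (intro nn_integral_count_space') auto
      also have "\<dots> = (\<Sum>x\<in>points (X \<omega>) \<inter> {0..1}.
          ennreal (F (shift x (diff_measure (X \<omega>) (return borel x)))))"
        by (intro sum.cong) (auto simp: F_def emeasure_shift_reduced[OF \<mu>])
      also have "\<dots> = ennreal (\<Sum>x\<in>points (X \<omega>) \<inter> {0..1}. F (shift x (diff_measure (X \<omega>) (return borel x))))"
        by (intro sum_ennreal) (auto simp: F_def)
      finally have e: "close_points t (X \<omega>) =
          ennreal (\<Sum>x\<in>points (X \<omega>) \<inter> {0..1}. F (shift x (diff_measure (X \<omega>) (return borel x))))" .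
      have "0 \<le> (\<Sum>x\<in>points (X \<omega>) \<inter> {0..1}. F (shift x (diff_measure (X \<omega>) (return borel x))))"
        by (intro sum_nonneg) (auto simp: F_def)
      then show "(\<Sum>x\<in>points (X \<omega>) \<inter> {0..1}. F (shift x (diff_measure (X \<omega>) (return borel x)))) =
          enn2real (close_points t (X \<omega>))" unfolding e by simp
      show "close_points t (X \<omega>) < \<top>" unfolding e by simp
    qed
    have "(\<integral>\<omega>. (\<Sum>x\<in>points (X \<omega>) \<inter> {0..1}. F (shift x (diff_measure (X \<omega>) (return borel x)))) \<partial>\<Omega>) =
        (\<integral>\<omega>. enn2real (close_points t (X \<omega>)) \<partial>\<Omega>)"
      by (rule Bochner_Integration.integral_cong[OF refl eq(1)])
    \<comment> \<open>This holds for an infinite expectation too: the Bochner integral is then 0,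
      and so is \<open>enn2real\<close> of infinity. Finiteness is established only in the final
      proof.\<close>
    also have "\<dots> = enn2real (\<integral>\<^sup>+\<omega>. ennreal (enn2real (close_points t (X \<omega>))) \<partial>\<Omega>)"
      using measurable_compose[OF X measurable_close_points]
      by (intro integral_eq_nn_integral) auto
    also have "(\<integral>\<^sup>+\<omega>. ennreal (enn2real (close_points t (X \<omega>))) \<partial>\<Omega>) = (\<integral>\<^sup>+\<omega>. close_points t (X \<omega>) \<partial>\<Omega>)"
      using eq(2) by (intro nn_integral_cong) (simp add: ennreal_enn2real)
    finally show ?thesis .
  qed
  ultimately show ?thesis by simp
qed

section \<open>Pairs and triples of nearby points\<close>

lemma nn_integral_count_space_PiE_2:
  assumes "countable S"
  shows "(\<integral>\<^sup>+x. u x \<partial>count_space (PiE {..<2 :: nat} (\<lambda>_. S))) =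
    (\<integral>\<^sup>+a. \<integral>\<^sup>+b. u ((\<lambda>_. undefined)(0 := a, 1 := b)) \<partial>count_space S \<partial>count_space S)"
  unfolding numeral_2_eq_2 nn_integral_count_space_PiE_Suc[OF assms]
  by (simp add: nn_integral_count_space_finite fun_upd_def)

lemma nn_integral_count_space_PiE_3:
  assumes "countable S"
  shows "(\<integral>\<^sup>+x. u x \<partial>count_space (PiE {..<3 :: nat} (\<lambda>_. S))) =
    (\<integral>\<^sup>+a. \<integral>\<^sup>+b. \<integral>\<^sup>+c. u ((\<lambda>_. undefined)(0 := a, 1 := b, 2 := c))
       \<partial>count_space S \<partial>count_space S \<partial>count_space S)"
  unfolding numeral_3_eq_3 nn_integral_count_space_PiE_Suc[OF assms]
  by (simp add: nn_integral_count_space_finite numeral_2_eq_2 fun_upd_def)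

lemma of_bool_le_nn_integral_count_space:
  "of_bool (\<exists>y\<in>S. Q y) \<le> (\<integral>\<^sup>+y. of_bool (Q y) \<partial>count_space S)"
proof (cases "\<exists>y\<in>S. Q y")
  case True
  then obtain y where y: "y \<in> S" "Q y" by auto
  have "1 = (\<integral>\<^sup>+z. indicator {y} z \<partial>count_space S)" using y by simp
  also have "\<dots> \<le> (\<integral>\<^sup>+z. of_bool (Q z) \<partial>count_space S)"
    using y by (intro nn_integral_mono) (auto simp: indicator_def)
  finally show ?thesis using True by simp
qed simp

text \<open>If \<open>n\<close> points satisfy \<open>Q\<close>, this is \<open>n \<le> 1\<^bsub>n \<ge> 1\<^esub> + n (n - 1)\<close>.\<close>

lemma nn_integral_count_space_le_pairs:
  "(\<integral>\<^sup>+y. of_bool (Q y) \<partial>count_space S) \<le>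
    of_bool (\<exists>y\<in>S. Q y) + (\<integral>\<^sup>+y. \<integral>\<^sup>+z. of_bool (Q y \<and> Q z \<and> y \<noteq> z) \<partial>count_space S \<partial>count_space S)"
proof (cases "\<exists>y\<in>S. Q y \<and> (\<forall>z\<in>S. Q z \<longrightarrow> z = y)")
  case True
  then obtain y where y: "y \<in> S" "Q y" and uniq: "\<forall>z\<in>S. Q z \<longrightarrow> z = y" by blast
  have "(\<integral>\<^sup>+z. of_bool (Q z) \<partial>count_space S) = (\<integral>\<^sup>+z. indicator {y} z \<partial>count_space S)"
  proof (intro nn_integral_cong)
    fix z assume "z \<in> space (count_space S)"
    then have "Q z \<longleftrightarrow> z = y" using y uniq unfolding space_count_space by blast
    then show "of_bool (Q z) = (indicator {y} z :: ennreal)" by simp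
  qed
  also have "\<dots> = 1" using y(1) by simp
  also have "\<dots> = of_bool (\<exists>y\<in>S. Q y)" using bexI[of Q, OF y(2,1)] by simp
  finally show ?thesis by (simp add: add_increasing2)
next
  \<comment> \<open>Now either no point satisfies \<open>Q\<close>, or each one that does has a
    distinct partner; the double sum alone then dominates, even for infinitely many points.\<close>
  case False
  have "(\<integral>\<^sup>+y. of_bool (Q y) \<partial>count_space S) \<le>
      (\<integral>\<^sup>+y. \<integral>\<^sup>+z. of_bool (Q y \<and> Q z \<and> y \<noteq> z) \<partial>count_space S \<partial>count_space S)"
  proof (intro nn_integral_mono)
    fix y assume "y \<in> space (count_space S)"
    then have y: "y \<in> S" by simp
    have "of_bool (Q y) \<le> (of_bool (\<exists>z\<in>S. Q y \<and> Q z \<and> y \<noteq> z) :: ennreal)"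
      using False y by (auto simp: of_bool_def)
    also have "\<dots> \<le> (\<integral>\<^sup>+z. of_bool (Q y \<and> Q z \<and> y \<noteq> z) \<partial>count_space S)"
      by (rule of_bool_le_nn_integral_count_space)
    finally show "of_bool (Q y) \<le> (\<integral>\<^sup>+z. of_bool (Q y \<and> Q z \<and> y \<noteq> z) \<partial>count_space S)" .
  qed
  then show ?thesis by (simp add: add_increasing)
qed

definition near_pair :: "real \<Rightarrow> (nat \<Rightarrow> complex) \<Rightarrow> ennreal" where
  "near_pair t x = of_bool (Re (x 0) \<in> {0..1} \<and> Re (x 1) - Re (x 0) \<in> {0<..t})"

text \<open>The two right-hand points are not ordered between themselves, in agreement with
  \<open>n (n - 1)\<close>; in \<open>near_pair\<close> the positive difference fixes the order, so
  a pair is counted once.\<close>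

definition near_triple :: "real \<Rightarrow> (nat \<Rightarrow> complex) \<Rightarrow> ennreal" where
  "near_triple t x = of_bool (Re (x 0) \<in> {0..1} \<and> Re (x 1) - Re (x 0) \<in> {0<..t} \<and> Re (x 2) - Re (x 0) \<in> {0<..t})"

lemma upper_half_plane_borel: "upper_half_plane \<in> sets borel"
  unfolding upper_half_plane_def by measurable

text \<open>For each left point \<open>a\<close>, the elementary inequalities are applied to the
  number \<open>n\<close> of points \<open>b\<close> with \<open>Re b - Re a\<close> in
  \<open>{0<..t}\<close>, and then summed over \<open>a\<close>. Points sharing an abscissa cause no
  trouble, as the projected measure counts them with multiplicity.\<close>

lemma close_points_projection:
  assumes \<mu>: "\<mu> \<in> conf upper_half_plane"
  shows "close_points t (distr \<mu> borel Re) \<le>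
    (\<integral>\<^sup>+x. near_pair t x * indicator {x. inj_on x {..<2}} x \<partial>count_space (PiE {..<2} (\<lambda>_. points \<mu>)))"
    (is ?lower)
  and "(\<integral>\<^sup>+x. near_pair t x * indicator {x. inj_on x {..<2}} x \<partial>count_space (PiE {..<2} (\<lambda>_. points \<mu>))) \<le>
    close_points t (distr \<mu> borel Re) +
    (\<integral>\<^sup>+x. near_triple t x * indicator {x. inj_on x {..<3}} x \<partial>count_space (PiE {..<3} (\<lambda>_. points \<mu>)))"
    (is ?upper)
proof -
  let ?S = "points \<mu>"
  let ?C = "count_space ?S"
  let ?Q = "\<lambda>a b. Re b - Re a \<in> {0<..t}"
  have cS: "countable ?S" by (rule countable_points_conf[OF exhaustion_upper_half_plane \<mu>])
  have sets: "sets \<mu> = sets (restrict_space borel upper_half_plane)" using \<mu> by simp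
  have Re[measurable]: "Re \<in> borel_measurable \<mu>"
    using sets by (simp cong: measurable_cong_sets add: measurable_restrict_space1)
  have e: "emeasure (distr \<mu> borel Re) {x<..x + t} \<noteq> 0 \<longleftrightarrow> (\<exists>b\<in>?S. Re b - x \<in> {0<..t})" for x
  proof -
    have "Re -` {x<..x + t} \<inter> space \<mu> \<in> sets (restrict_space borel upper_half_plane)"
      using measurable_sets[OF Re, of "{x<..x + t}"] sets by simp
    then have "emeasure (distr \<mu> borel Re) {x<..x + t} = 0 \<longleftrightarrow> ?S \<inter> (Re -` {x<..x + t} \<inter> space \<mu>) = {}"
      using emeasure_conf_eq_0_iff[OF \<mu>] by (simp add: emeasure_distr)
    moreover have "?S \<subseteq> space \<mu>" by (auto simp: points_def)
    ultimately show ?thesis by auto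
  qed
  \<comment> \<open>Having a right neighbour within distance \<open>t\<close> is membership in a
    countable union of intervals, hence Borel; this permits the change of variables to the
    half-plane.\<close>
  have sigma: "{x. \<exists>b\<in>?S. Re b - x \<in> {0<..t}} \<in> sets borel"
  proof -
    have "{x. \<exists>b\<in>?S. Re b - x \<in> {0<..t}} = (\<Union>b\<in>?S. {Re b - t..<Re b})" by auto
    also have "\<dots> \<in> sets borel" using cS by (intro sets.countable_UN') auto
    finally show ?thesis .
  qed
  have ob: "of_bool (\<exists>b\<in>?S. Re b - x \<in> {0<..t}) = (indicator {x. \<exists>b\<in>?S. Re b - x \<in> {0<..t}} x :: ennreal)" for x
    by (simp add: indicator_def)
  have m: "(\<lambda>x. indicator {0..1} x * of_bool (\<exists>b\<in>?S. Re b - x \<in> {0<..t}) :: ennreal) \<in> borel_measurable borel"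
    unfolding ob using sigma by measurable
  have "close_points t (distr \<mu> borel Re) =
      (\<integral>\<^sup>+z. indicator {0..1} (Re z) * of_bool (\<exists>b\<in>?S. ?Q z b) \<partial>\<mu>)"
    unfolding close_points_def e using m by (subst nn_integral_distr) auto
  also have "\<dots> = (\<integral>\<^sup>+z. indicator {0..1} (Re z) * of_bool (\<exists>b\<in>?S. ?Q z b) \<partial>?C)"
  proof (rule nn_integral_conf[OF \<mu>])
    have "(\<lambda>z. indicator {0..1} (Re z) * of_bool (\<exists>b\<in>?S. ?Q z b) :: ennreal) \<in> borel_measurable borel"
      by (rule measurable_compose[OF _ m]) auto
    then show "(\<lambda>z. indicator {0..1} (Re z) * of_bool (\<exists>b\<in>?S. ?Q z b) :: ennreal)
        \<in> borel_measurable (restrict_space borel upper_half_plane)"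
      by (rule measurable_restrict_space1)
  qed
  finally have eq: "close_points t (distr \<mu> borel Re) =
      (\<integral>\<^sup>+a. of_bool (Re a \<in> {0..1}) * of_bool (\<exists>b\<in>?S. ?Q a b) \<partial>?C)"
    by (simp add: indicator_def of_bool_def)
  have i2: "inj_on ((\<lambda>_. undefined)(0 := a, 1 := b)) {..<2 :: nat} \<longleftrightarrow> a \<noteq> b" for a b :: complex
    by (auto simp: numeral_2_eq_2 lessThan_Suc)
  have i3: "inj_on ((\<lambda>_. undefined)(0 := a, 1 := b, 2 := c)) {..<3 :: nat} \<longleftrightarrow> a \<noteq> b \<and> a \<noteq> c \<and> b \<noteq> c"
    for a b c :: complex
    by (auto simp: numeral_3_eq_3 numeral_2_eq_2 lessThan_Suc)
  have pair: "(\<integral>\<^sup>+x. near_pair t x * indicator {x. inj_on x {..<2}} x \<partial>count_space (PiE {..<2} (\<lambda>_. ?S))) =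
      (\<integral>\<^sup>+a. of_bool (Re a \<in> {0..1}) * (\<integral>\<^sup>+b. of_bool (?Q a b) \<partial>?C) \<partial>?C)"
    unfolding nn_integral_count_space_PiE_2[OF cS]
  proof (rule nn_integral_cong)
    fix a
    \<comment> \<open>Distinctness of \<open>a\<close> and \<open>b\<close> is automatic, because
      their abscissae differ by a positive amount.\<close>
    have "near_pair t ((\<lambda>_. undefined)(0 := a, 1 := b)) *
        indicator {x. inj_on x {..<2 :: nat}} ((\<lambda>_. undefined)(0 := a, 1 := b)) =
        of_bool (Re a \<in> {0..1}) * of_bool (?Q a b)" for b
      unfolding indicator_def mem_Collect_eq i2 near_pair_def by (cases "a = b") simp_all
    then show "(\<integral>\<^sup>+b. near_pair t ((\<lambda>_. undefined)(0 := a, 1 := b)) *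
        indicator {x. inj_on x {..<2 :: nat}} ((\<lambda>_. undefined)(0 := a, 1 := b)) \<partial>?C) =
        of_bool (Re a \<in> {0..1}) * (\<integral>\<^sup>+b. of_bool (?Q a b) \<partial>?C)"
      by (simp add: nn_integral_cmult)
  qed
  have triple: "(\<integral>\<^sup>+x. near_triple t x * indicator {x. inj_on x {..<3}} x \<partial>count_space (PiE {..<3} (\<lambda>_. ?S))) =
      (\<integral>\<^sup>+a. of_bool (Re a \<in> {0..1}) * (\<integral>\<^sup>+b. \<integral>\<^sup>+c. of_bool (?Q a b \<and> ?Q a c \<and> b \<noteq> c) \<partial>?C \<partial>?C) \<partial>?C)"
    unfolding nn_integral_count_space_PiE_3[OF cS]
  proof (rule nn_integral_cong)
    fix a
    have "near_triple t ((\<lambda>_. undefined)(0 := a, 1 := b, 2 := c)) *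
        indicator {x. inj_on x {..<3 :: nat}} ((\<lambda>_. undefined)(0 := a, 1 := b, 2 := c)) =
        of_bool (Re a \<in> {0..1}) * of_bool (?Q a b \<and> ?Q a c \<and> b \<noteq> c)" for b c
      unfolding indicator_def mem_Collect_eq i3 near_triple_def by (cases "a = b"; cases "a = c") simp_all
    then show "(\<integral>\<^sup>+b. \<integral>\<^sup>+c. near_triple t ((\<lambda>_. undefined)(0 := a, 1 := b, 2 := c)) *
        indicator {x. inj_on x {..<3 :: nat}} ((\<lambda>_. undefined)(0 := a, 1 := b, 2 := c)) \<partial>?C \<partial>?C) =
        of_bool (Re a \<in> {0..1}) * (\<integral>\<^sup>+b. \<integral>\<^sup>+c. of_bool (?Q a b \<and> ?Q a c \<and> b \<noteq> c) \<partial>?C \<partial>?C)"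
      by (simp add: nn_integral_cmult)
  qed
  show ?lower
    unfolding eq pair by (intro nn_integral_mono mult_left_mono of_bool_le_nn_integral_count_space) auto
  have "(\<integral>\<^sup>+a. of_bool (Re a \<in> {0..1}) * (\<integral>\<^sup>+b. of_bool (?Q a b) \<partial>?C) \<partial>?C) \<le>
      (\<integral>\<^sup>+a. of_bool (Re a \<in> {0..1}) * of_bool (\<exists>b\<in>?S. ?Q a b) +
        of_bool (Re a \<in> {0..1}) * (\<integral>\<^sup>+b. \<integral>\<^sup>+c. of_bool (?Q a b \<and> ?Q a c \<and> b \<noteq> c) \<partial>?C \<partial>?C) \<partial>?C)"
    unfolding distrib_left[symmetric]
    by (intro nn_integral_mono mult_left_mono nn_integral_count_space_le_pairs) auto
  then show ?upper
    unfolding eq pair triple by (simp add: nn_integral_add)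
qed

section \<open>The kernel and its determinants\<close>

lemma det_mat_2:
  "Determinant.det (Matrix.mat 2 2 f) = f (0, 0) * f (1, 1) - f (0, 1) * (f (1, 0) :: 'a::comm_ring_1)"
proof -
  have s: "{0..<2 :: nat} = {0, 1}" by auto
  have p: "{p. p permutes {0, 1 :: nat}} = {id, Transposition.transpose 0 1}"
    by (auto simp: permutes_doubleton_iff)
  have ne: "id \<noteq> Transposition.transpose 0 (1 :: nat)"
    by (metis id_apply transpose_apply_first zero_neq_one)
  have "Determinant.det (Matrix.mat 2 2 f) =
      (\<Sum>p\<in>{id, Transposition.transpose 0 1}. signof p * (\<Prod>i\<in>{0, 1}. Matrix.mat 2 2 f $$ (i, p i)))"
    unfolding det_def'[OF mat_carrier] s p ..
  also have "\<dots> = f (0, 0) * f (1, 1) - f (0, 1) * f (1, 0)"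
    using ne by (simp add: sign_swap_id sign_id)
  finally show ?thesis .
qed

text \<open>Leibniz expansion: there are \<open>fact k\<close> terms, each a product of
  \<open>k\<close> entries. This crude bound suffices for triples, where only the order in
  \<open>t\<close> matters.\<close>

lemma norm_det_mat_le:
  fixes f :: "nat \<times> nat \<Rightarrow> complex"
  assumes "\<And>i j. i < k \<Longrightarrow> j < k \<Longrightarrow> norm (f (i, j)) \<le> c"
  shows "norm (Determinant.det (Matrix.mat k k f)) \<le> fact k * c ^ k"
proof -
  have "norm (Determinant.det (Matrix.mat k k f)) \<le>
      (\<Sum>p\<in>{p. p permutes {0..<k}}. norm (signof p * (\<Prod>i = 0..<k. Matrix.mat k k f $$ (i, p i))))"
    by (subst det_def'[of _ k]) (auto intro: norm_sum)
  also have "\<dots> \<le> (\<Sum>p\<in>{p. p permutes {0..<k}}. c ^ k)"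
  proof (intro sum_mono)
    fix p assume "p \<in> {p. p permutes {0..<k}}"
    then have p: "p permutes {0..<k}" by simp
    have "norm (\<Prod>i = 0..<k. Matrix.mat k k f $$ (i, p i)) = (\<Prod>i = 0..<k. norm (Matrix.mat k k f $$ (i, p i)))"
      by (simp add: prod_norm)
    also have "\<dots> \<le> (\<Prod>i = 0..<k. c)"
    proof (intro prod_mono conjI norm_ge_zero)
      fix i assume i: "i \<in> {0..<k}"
      then have "p i \<in> {0..<k}" using permutes_in_image[OF p] by blast
      then show "norm (Matrix.mat k k f $$ (i, p i)) \<le> c" using i assms by simp
    qed
    finally have "norm (\<Prod>i = 0..<k. Matrix.mat k k f $$ (i, p i)) \<le> c ^ k" by simp
    then show "norm (signof p * (\<Prod>i = 0..<k. Matrix.mat k k f $$ (i, p i))) \<le> c ^ k"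
      by (simp add: sign_def)
  qed
  also have "\<dots> = fact k * c ^ k" by (simp add: card_permutations)
  finally show ?thesis .
qed

lemma measurable_det_mat:
  fixes f :: "'a \<Rightarrow> nat \<times> nat \<Rightarrow> complex"
  assumes "\<And>i j. i < k \<Longrightarrow> j < k \<Longrightarrow> (\<lambda>x. f x (i, j)) \<in> borel_measurable M"
  shows "(\<lambda>x. Determinant.det (Matrix.mat k k (f x))) \<in> borel_measurable M"
proof -
  have e: "Determinant.det (Matrix.mat k k (f x)) =
      (\<Sum>p\<in>{p. p permutes {0..<k}}. signof p * (\<Prod>i = 0..<k. f x (i, p i)))" for x
  proof -
    have "Determinant.det (Matrix.mat k k (f x)) =
        (\<Sum>p\<in>{p. p permutes {0..<k}}. signof p * (\<Prod>i = 0..<k. Matrix.mat k k (f x) $$ (i, p i)))"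
      by (rule det_def') simp
    also have "\<dots> = (\<Sum>p\<in>{p. p permutes {0..<k}}. signof p * (\<Prod>i = 0..<k. f x (i, p i)))"
    proof (intro sum.cong prod.cong refl arg_cong2[where f = "(*)"])
      fix p i assume "p \<in> {p. p permutes {0..<k}}" "i \<in> {0..<k}"
      moreover from this have "p i \<in> {0..<k}" using permutes_in_image[of p "{0..<k}"] by blast
      ultimately show "Matrix.mat k k (f x) $$ (i, p i) = f x (i, p i)" by simp
    qed
    finally show ?thesis .
  qed
  show ?thesis
    unfolding e
  proof (intro borel_measurable_sum borel_measurable_times borel_measurable_prod measurable_const)
    fix p i assume "p \<in> {p. p permutes {0..<k}}" "i \<in> {0..<k}"
    moreover from this have "p i \<in> {0..<k}" using permutes_in_image[of p "{0..<k}"] by blast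
    ultimately show "(\<lambda>x. f x (i, p i)) \<in> borel_measurable M" by (intro assms) auto
  qed simp
qed

text \<open>Conjugation makes the heights add up, so the imaginary part of \<open>a - cnj b\<close>
  is at least \<open>2 * \<alpha>\<close>.\<close>

lemma norm_K_H_le:
  assumes "0 < \<alpha>" "\<alpha> \<le> Im a" "\<alpha> \<le> Im b"
  shows "norm (K_H a b) \<le> 1 / (4 * pi * \<alpha>\<^sup>2)"
proof -
  have "2 * \<alpha> \<le> \<bar>Im (a - cnj b)\<bar>" using assms by simp
  also have "\<dots> \<le> norm (a - cnj b)" by (rule abs_Im_le_cmod)
  finally have "(2 * \<alpha>)\<^sup>2 \<le> (norm (a - cnj b))\<^sup>2" using assms by (intro power_mono) auto
  then have "4 * pi * \<alpha>\<^sup>2 \<le> pi * (norm (a - cnj b))\<^sup>2" by (simp add: power_mult_distrib)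
  then have "1 / (pi * (norm (a - cnj b))\<^sup>2) \<le> 1 / (4 * pi * \<alpha>\<^sup>2)"
    using assms by (intro divide_left_mono) (auto intro!: mult_pos_pos)
  then show ?thesis by (simp add: K_H_def norm_divide norm_mult norm_power)
qed

text \<open>The two-point density of the half-plane process at heights \<open>y\<close>,
  \<open>v\<close> and horizontal offset \<open>r\<close>: the product of the diagonal kernel values
  \<open>1 / (4 * pi * y^2)\<close> and \<open>1 / (4 * pi * v^2)\<close>, minus the squared modulus
  of the off-diagonal value.\<close>

definition pair_density :: "real \<Rightarrow> real \<Rightarrow> real \<Rightarrow> real" where
  "pair_density r y v = 1 / (16 * pi\<^sup>2 * y\<^sup>2 * v\<^sup>2) - 1 / (pi\<^sup>2 * (r\<^sup>2 + (y + v)\<^sup>2)\<^sup>2)"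

text \<open>The kernel is Hermitian, so the product of the off-diagonal entries is a squared norm;
  on the diagonal, \<open>z - cnj z\<close> is purely imaginary, which cancels the minus sign of the
  kernel.\<close>

lemma Re_det_K_H_2:
  assumes "Im a > 0" "Im b > 0"
  shows "Re (Determinant.det (Matrix.mat 2 2 (\<lambda>(i, j). K_H (([a, b]) ! i) (([a, b]) ! j)))) =
    pair_density (Re b - Re a) (Im a) (Im b)"
proof -
  have diag: "K_H z z = of_real (1 / (4 * pi * (Im z)\<^sup>2))" for z
  proof -
    have "(z - cnj z)\<^sup>2 = - of_real (4 * (Im z)\<^sup>2)"
      by (simp add: complex_diff_cnj power_mult_distrib)
    then show ?thesis by (simp add: K_H_def)
  qed
  have cc: "K_H b a = cnj (K_H a b)"
  proof -
    have "cnj ((a - cnj b)\<^sup>2) = (b - cnj a)\<^sup>2"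
      by (simp add: power2_commute)
    then show ?thesis by (simp add: K_H_def)
  qed
  have "(norm (a - cnj b))\<^sup>2 = (Re b - Re a)\<^sup>2 + (Im a + Im b)\<^sup>2"
    by (simp add: cmod_power2 power2_commute)
  then have n4: "(norm (a - cnj b))^4 = ((Re b - Re a)\<^sup>2 + (Im a + Im b)\<^sup>2)\<^sup>2"
    by (metis numeral_Bit0 power_add power2_eq_square)
  have "K_H a b * K_H b a = of_real ((norm (K_H a b))\<^sup>2)"
    unfolding cc by (rule complex_norm_square[symmetric])
  also have "(norm (K_H a b))\<^sup>2 = 1 / (pi\<^sup>2 * (norm (a - cnj b))^4)"
    by (simp add: K_H_def norm_divide norm_mult norm_power power_divide power_mult_distrib flip: power_mult)
  finally have off: "K_H a b * K_H b a = of_real (1 / (pi\<^sup>2 * ((Re b - Re a)\<^sup>2 + (Im a + Im b)\<^sup>2)\<^sup>2))"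
    unfolding n4 .
  have "K_H a a * K_H b b = of_real (1 / (16 * pi\<^sup>2 * (Im a)\<^sup>2 * (Im b)\<^sup>2))"
    unfolding diag by (simp add: power2_eq_square field_simps)
  with off show ?thesis unfolding det_mat_2 pair_density_def by simp
qed

lemma pair_density_0_pos:
  assumes "0 < y" "0 < v" "y \<noteq> v"
  shows "0 < pair_density 0 y v"
proof -
  have "4 * y * v < (y + v)\<^sup>2"
  proof -
    have "0 < (y - v)\<^sup>2" using assms by simp
    then show ?thesis by (simp add: power2_eq_square algebra_simps)
  qed
  then have "(4 * y * v)\<^sup>2 < ((y + v)\<^sup>2)\<^sup>2" using assms by (intro power_strict_mono) auto
  then have "pi\<^sup>2 * (16 * y\<^sup>2 * v\<^sup>2) < pi\<^sup>2 * ((y + v)\<^sup>2)\<^sup>2" by (simp add: power_mult_distrib)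
  then have "1 / (pi\<^sup>2 * ((y + v)\<^sup>2)\<^sup>2) < 1 / (pi\<^sup>2 * (16 * y\<^sup>2 * v\<^sup>2))"
    using assms by (intro divide_strict_left_mono) auto
  then show ?thesis by (simp add: pair_density_def ac_simps)
qed

lemma pair_density_0_nonneg:
  assumes "0 < y" "0 < v"
  shows "0 \<le> pair_density 0 y v"
proof (cases "y = v")
  case True
  then show ?thesis using assms by (simp add: pair_density_def power2_eq_square field_simps)
qed (use pair_density_0_pos[OF assms] in simp)

text \<open>Moving the points apart horizontally only weakens the repulsion. Hence the lower bound
  for pairs carries no error term.\<close>

lemma pair_density_ge:
  assumes "0 < y" "0 < v"
  shows "pair_density 0 y v \<le> pair_density r y v"
proof -
  have "((y + v)\<^sup>2)\<^sup>2 \<le> (r\<^sup>2 + (y + v)\<^sup>2)\<^sup>2" by (intro power_mono) auto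
  then have "1 / (pi\<^sup>2 * (r\<^sup>2 + (y + v)\<^sup>2)\<^sup>2) \<le> 1 / (pi\<^sup>2 * ((y + v)\<^sup>2)\<^sup>2)"
    using assms by (intro divide_left_mono mult_left_mono mult_pos_pos) (auto simp: add_nonneg_pos)
  then show ?thesis by (simp add: pair_density_def)
qed

text \<open>With \<open>s = (y + v)^2\<close>, the difference of the two reciprocal squares is at
  most \<open>2 * r^2 / s^3\<close>, and \<open>s\<close> is at least
  \<open>(2 * \<alpha>)^2\<close>; this is the origin of the sixth power.\<close>

lemma pair_density_le:
  assumes \<alpha>: "0 < \<alpha>" "\<alpha> \<le> y" "\<alpha> \<le> v" and r: "0 \<le> r" "r \<le> t" "t \<le> 1"
  shows "pair_density r y v \<le> pair_density 0 y v + 2 / (pi\<^sup>2 * (2 * \<alpha>)^6) * t"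
proof -
  define s where "s = (y + v)\<^sup>2"
  have s: "(2 * \<alpha>)\<^sup>2 \<le> s" unfolding s_def using \<alpha> by (intro power_mono) auto
  have \<alpha>2: "0 < (2 * \<alpha>)\<^sup>2" using \<alpha> by simp
  have s0: "0 < s" using s \<alpha>2 by linarith
  have "1 / s\<^sup>2 - 1 / (r\<^sup>2 + s)\<^sup>2 = r\<^sup>2 * (r\<^sup>2 + 2 * s) / (s\<^sup>2 * (r\<^sup>2 + s)\<^sup>2)"
  proof -
    have "r\<^sup>2 + s \<noteq> 0" using s0 by (simp add: add_nonneg_pos less_imp_neq[symmetric])
    then have "1 / s\<^sup>2 - 1 / (r\<^sup>2 + s)\<^sup>2 = ((r\<^sup>2 + s)\<^sup>2 - s\<^sup>2) / (s\<^sup>2 * (r\<^sup>2 + s)\<^sup>2)"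
      using s0 by (simp add: diff_frac_eq)
    also have "(r\<^sup>2 + s)\<^sup>2 - s\<^sup>2 = r\<^sup>2 * (r\<^sup>2 + 2 * s)" by (simp add: power2_eq_square algebra_simps)
    finally show ?thesis .
  qed
  also have "\<dots> \<le> r\<^sup>2 * (2 * (r\<^sup>2 + s)) / (s\<^sup>2 * (r\<^sup>2 + s)\<^sup>2)"
    using s0 by (intro divide_right_mono mult_left_mono) auto
  also have "\<dots> = 2 * r\<^sup>2 / (s\<^sup>2 * (r\<^sup>2 + s))"
  proof -
    have "r\<^sup>2 * (2 * q) / (s\<^sup>2 * q\<^sup>2) = 2 * r\<^sup>2 / (s\<^sup>2 * q)" if "q \<noteq> 0" for q
      using that by (simp add: power2_eq_square ac_simps)
    moreover have "r\<^sup>2 + s \<noteq> 0" using s0 by (simp add: add_nonneg_pos less_imp_neq[symmetric])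
    ultimately show ?thesis .
  qed
  also have "\<dots> \<le> 2 * r\<^sup>2 / ((2 * \<alpha>)^6)"
  proof (intro divide_left_mono)
    have "((2 * \<alpha>)\<^sup>2)\<^sup>2 * (2 * \<alpha>)\<^sup>2 \<le> s\<^sup>2 * (r\<^sup>2 + s)"
      using s s0 by (intro mult_mono power_mono add_increasing) auto
    then show "(2 * \<alpha>)^6 \<le> s\<^sup>2 * (r\<^sup>2 + s)" by (simp flip: power_mult power_add)
    show "0 < s\<^sup>2 * (r\<^sup>2 + s) * (2 * \<alpha>)^6" using s0 \<alpha> by (intro mult_pos_pos) (auto simp: add_nonneg_pos)
  qed auto
  \<comment> \<open>Weakening \<open>r^2\<close> to \<open>t\<close> is affordable: integrating over
    the offset in \<open>{0<..t}\<close> supplies a second factor \<open>t\<close>.\<close>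
  also have "\<dots> \<le> 2 * t / ((2 * \<alpha>)^6)"
  proof (intro divide_right_mono mult_left_mono)
    have "r\<^sup>2 \<le> t\<^sup>2" using r by (intro power_mono) auto
    also have "\<dots> \<le> t" using r by (simp add: power2_eq_square mult_left_le)
    finally show "r\<^sup>2 \<le> t" .
  qed (use \<alpha> in auto)
  finally have "1 / pi\<^sup>2 * (1 / s\<^sup>2 - 1 / (r\<^sup>2 + s)\<^sup>2) \<le> 1 / pi\<^sup>2 * (2 * t / ((2 * \<alpha>)^6))"
    by (intro mult_left_mono) auto
  then show ?thesis by (simp add: pair_density_def s_def right_diff_distrib)
qed

section \<open>Integrals over the half-plane\<close>

lemma lborel_complex:
  "(lborel :: complex measure) = distr (lborel \<Otimes>\<^sub>M lborel) borel (\<lambda>(x, y). Complex x y)"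
proof (rule lborel_eqI)
  have m: "(\<lambda>(x, y). Complex x y) \<in> borel_measurable (lborel \<Otimes>\<^sub>M lborel)"
    unfolding Complex_eq split_beta by measurable
  fix l u :: complex
  assume "\<And>b. b \<in> Basis \<Longrightarrow> l \<bullet> b \<le> u \<bullet> b"
  from this[of 1] this[of \<i>] have le: "Re l \<le> Re u" "Im l \<le> Im u"
    by (auto simp: Basis_complex_def)
  have "emeasure (distr (lborel \<Otimes>\<^sub>M lborel) borel (\<lambda>(x, y). Complex x y)) (box l u) =
      emeasure (lborel \<Otimes>\<^sub>M lborel) ({Re l<..<Re u} \<times> {Im l<..<Im u})"
    using m by (subst emeasure_distr) (auto simp: space_pair_measure mem_box Basis_complex_def intro!: arg_cong2[where f = emeasure])
  also have "\<dots> = ennreal (Re u - Re l) * ennreal (Im u - Im l)"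
    using le by (subst lborel.emeasure_pair_measure_Times) auto
  also have "\<dots> = ennreal (\<Prod>b\<in>Basis. (u - l) \<bullet> b)"
    using le by (simp add: Basis_complex_def ennreal_mult)
  finally show "emeasure (distr (lborel \<Otimes>\<^sub>M lborel) borel (\<lambda>(x, y). Complex x y)) (box l u) =
      ennreal (\<Prod>b\<in>Basis. (u - l) \<bullet> b)" .
qed simp

lemma nn_integral_lborel_complex:
  assumes f: "f \<in> borel_measurable borel"
  shows "(\<integral>\<^sup>+z. f z \<partial>(lborel :: complex measure)) = (\<integral>\<^sup>+x. \<integral>\<^sup>+y. f (Complex x y) \<partial>lborel \<partial>lborel)"
proof -
  have m: "(\<lambda>(x, y). Complex x y) \<in> borel_measurable (lborel \<Otimes>\<^sub>M lborel)"
    unfolding Complex_eq split_beta by measurable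
  have "(\<integral>\<^sup>+z. f z \<partial>(lborel :: complex measure)) =
      (\<integral>\<^sup>+z. f ((\<lambda>(x, y). Complex x y) z) \<partial>(lborel \<Otimes>\<^sub>M lborel))"
    using f by (subst lborel_complex, subst nn_integral_distr[OF m]) auto
  also have "\<dots> = (\<integral>\<^sup>+x. \<integral>\<^sup>+y. f (Complex x y) \<partial>lborel \<partial>lborel)"
    using measurable_compose[OF m f] by (subst lborel.nn_integral_fst[symmetric]) auto
  finally show ?thesis .
qed

text \<open>The second claim keeps the partially integrated function measurable, so that the first
  can be iterated.\<close>

lemma nn_integral_PiM_Suc:
  assumes R: "sigma_finite_measure R" and f: "f \<in> borel_measurable (PiM {..<Suc k} (\<lambda>_. R))"
  shows "(\<integral>\<^sup>+x. f x \<partial>PiM {..<Suc k} (\<lambda>_. R)) = (\<integral>\<^sup>+x. \<integral>\<^sup>+y. f (x(k := y)) \<partial>R \<partial>PiM {..<k} (\<lambda>_. R))"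
    and "(\<lambda>x. \<integral>\<^sup>+y. f (x(k := y)) \<partial>R) \<in> borel_measurable (PiM {..<k} (\<lambda>_. R))"
proof -
  interpret product_sigma_finite "\<lambda>_ :: nat. R" using R by (simp add: product_sigma_finite_def)
  have f': "f \<in> borel_measurable (PiM (insert k {..<k}) (\<lambda>_. R))" using f by (simp add: lessThan_Suc)
  show "(\<integral>\<^sup>+x. f x \<partial>PiM {..<Suc k} (\<lambda>_. R)) = (\<integral>\<^sup>+x. \<integral>\<^sup>+y. f (x(k := y)) \<partial>R \<partial>PiM {..<k} (\<lambda>_. R))"
    unfolding lessThan_Suc using f' by (intro product_nn_integral_insert) auto
  have m: "(\<lambda>z. f ((\<lambda>(x, y). x(k := y)) z)) \<in> borel_measurable (PiM {..<k} (\<lambda>_. R) \<Otimes>\<^sub>M R)"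
    by (rule measurable_compose[OF measurable_add_dim f'])
  show "(\<lambda>x. \<integral>\<^sup>+y. f (x(k := y)) \<partial>R) \<in> borel_measurable (PiM {..<k} (\<lambda>_. R))"
    using sigma_finite_measure.borel_measurable_nn_integral_fst[OF R m] by simp
qed

lemma nn_integral_PiM_0: "(\<integral>\<^sup>+x. f x \<partial>PiM {..<0 :: nat} (\<lambda>_. R)) = f (\<lambda>_. undefined)"
  by (simp add: PiM_empty nn_integral_count_space_finite)

lemma nn_integral_PiM_2:
  assumes R: "sigma_finite_measure R" and f: "f \<in> borel_measurable (PiM {..<2 :: nat} (\<lambda>_. R))"
  shows "(\<integral>\<^sup>+x. f x \<partial>PiM {..<2 :: nat} (\<lambda>_. R)) = (\<integral>\<^sup>+a. \<integral>\<^sup>+b. f ((\<lambda>_. undefined)(0 := a, 1 := b)) \<partial>R \<partial>R)"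
proof -
  note s = nn_integral_PiM_Suc[OF R]
  note f2 = f[unfolded numeral_2_eq_2]
  show ?thesis
    unfolding numeral_2_eq_2 s(1)[OF f2] s(1)[OF s(2)[OF f2]] nn_integral_PiM_0 One_nat_def ..
qed

lemma nn_integral_PiM_3:
  assumes R: "sigma_finite_measure R" and f: "f \<in> borel_measurable (PiM {..<3 :: nat} (\<lambda>_. R))"
  shows "(\<integral>\<^sup>+x. f x \<partial>PiM {..<3 :: nat} (\<lambda>_. R)) =
    (\<integral>\<^sup>+a. \<integral>\<^sup>+b. \<integral>\<^sup>+c. f ((\<lambda>_. undefined)(0 := a, 1 := b, 2 := c)) \<partial>R \<partial>R \<partial>R)"
proof -
  note s = nn_integral_PiM_Suc[OF R]
  note f3 = f[unfolded numeral_3_eq_3]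
  show ?thesis
    unfolding numeral_3_eq_3 s(1)[OF f3] s(1)[OF s(2)[OF f3]] s(1)[OF s(2)[OF s(2)[OF f3]]]
      nn_integral_PiM_0 One_nat_def numeral_2_eq_2 ..
qed

section \<open>The leading coefficient\<close>

lemma integrable_interval:
  fixes f :: "real \<Rightarrow> real"
  assumes "f \<in> borel_measurable borel" "\<And>y. y \<in> {a..b} \<Longrightarrow> \<bar>f y\<bar> \<le> c" "\<And>y. y \<notin> {a..b} \<Longrightarrow> f y = 0"
  shows "integrable lborel f"
proof (rule Bochner_Integration.integrable_bound)
  show "integrable lborel (\<lambda>y. \<bar>c\<bar> * indicator {a..b} y :: real)"
    by (intro integrable_mult_right integrable_real_indicator) (auto simp: emeasure_lborel_Icc_eq)
  have "norm (f y) \<le> norm (\<bar>c\<bar> * indicator {a..b} y :: real)" for y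
    using assms(2,3)[of y] by (cases "y \<in> {a..b}") auto
  then show "AE y in lborel. norm (f y) \<le> norm (\<bar>c\<bar> * indicator {a..b} y :: real)" by simp
qed (use assms in simp)

section \<open>Integrals attached to one retention function\<close>

locale retention =
  fixes \<alpha> \<beta> :: real and w :: "real \<Rightarrow> real"
  assumes \<alpha>: "0 < \<alpha>" and \<alpha>\<beta>: "\<alpha> < \<beta>" and w: "w \<in> retention_class \<alpha> \<beta>"
begin

text \<open>Nothing is known about \<open>w\<close> at nonpositive heights; the extension by zero is
  Borel on the whole line and turns set integrals into plain ones.\<close>

definition W :: "real \<Rightarrow> real" where "W y = indicator {0<..} y * w y"

lemma W_pos: "0 < y \<Longrightarrow> W y = w y" by (simp add: W_def)

lemma w_range: "0 < y \<Longrightarrow> 0 \<le> w y \<and> w y \<le> 1"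
  using w by (auto simp: retention_class_def)

lemma W_measurable [measurable]: "W \<in> borel_measurable borel"
proof -
  have "w \<in> borel_measurable (restrict_space borel {0<..})" using w by (auto simp: retention_class_def)
  then have "(\<lambda>y. indicator {0<..} y *\<^sub>R w y) \<in> borel_measurable borel"
    by (subst (asm) borel_measurable_restrict_space_iff) auto
  then show ?thesis by (simp add: W_def[abs_def])
qed

lemma W_nonneg: "0 \<le> W y"
  using w_range[of y] by (auto simp: W_def indicator_def)

lemma W_le_1: "W y \<le> 1"
  using w_range[of y] by (auto simp: W_def indicator_def)

lemma W_eq_0: "y \<notin> {\<alpha>..\<beta>} \<Longrightarrow> W y = 0"
  using w by (cases "0 < y") (auto simp: retention_class_def W_def)

lemma integrable_W: "integrable lborel W"
  by (rule integrable_interval[where a = \<alpha> and b = \<beta> and c = 1]) (auto simp: W_eq_0 W_nonneg W_le_1)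

lemma integral_W_pos: "0 < integral\<^sup>L lborel W"
proof -
  have "(LINT y:{\<alpha>..\<beta>}|lborel. w y) = integral\<^sup>L lborel W"
    unfolding set_lebesgue_integral_def
  proof (rule Bochner_Integration.integral_cong[OF refl])
    fix y show "indicator {\<alpha>..\<beta>} y *\<^sub>R w y = W y"
      using \<alpha> W_eq_0[of y] by (cases "y \<in> {\<alpha>..\<beta>}") (auto simp: W_def)
  qed
  then show ?thesis using w by (auto simp: retention_class_def)
qed

text \<open>The integrand of the double integral in \<open>rho2 w 0\<close>.\<close>

definition Q :: "real \<Rightarrow> real \<Rightarrow> real" where "Q y v = W y * W v / ((y + v)\<^sup>2)\<^sup>2"

lemma integrable_W_div: "integrable lborel (\<lambda>y. W y / y\<^sup>2)"
proof (rule integrable_interval[where a = \<alpha> and b = \<beta> and c = "1 / \<alpha>\<^sup>2"])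
  fix y assume "y \<in> {\<alpha>..\<beta>}"
  then have "\<alpha>\<^sup>2 \<le> y\<^sup>2" using \<alpha> by (intro power_mono) auto
  then have "W y / y\<^sup>2 \<le> 1 / \<alpha>\<^sup>2" using \<alpha> W_nonneg[of y] W_le_1[of y] by (intro frac_le) auto
  then show "\<bar>W y / y\<^sup>2\<bar> \<le> 1 / \<alpha>\<^sup>2" using W_nonneg[of y] by simp
qed (auto simp: W_eq_0)

lemma Q_nonneg: "0 \<le> Q y v" by (simp add: Q_def W_nonneg)

lemma Q_measurable [measurable]: "(\<lambda>(y, v). Q y v) \<in> borel_measurable (borel \<Otimes>\<^sub>M borel)"
  unfolding Q_def split_beta by measurable

lemma Q_eq_0: "y \<notin> {\<alpha>..\<beta>} \<or> v \<notin> {\<alpha>..\<beta>} \<Longrightarrow> Q y v = 0"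
  by (auto simp: Q_def W_eq_0)

lemma Q_le: "Q y v \<le> 1 / ((2 * \<alpha>)\<^sup>2)\<^sup>2 * indicator {\<alpha>..\<beta>} v"
proof (cases "y \<in> {\<alpha>..\<beta>} \<and> v \<in> {\<alpha>..\<beta>}")
  case True
  then have "((2 * \<alpha>)\<^sup>2)\<^sup>2 \<le> ((y + v)\<^sup>2)\<^sup>2" using \<alpha> by (intro power_mono) auto
  moreover have "W y * W v \<le> 1" using W_nonneg W_le_1 by (intro mult_le_one) auto
  ultimately have "Q y v \<le> 1 / ((2 * \<alpha>)\<^sup>2)\<^sup>2"
    unfolding Q_def using \<alpha> W_nonneg by (intro frac_le) auto
  then show ?thesis using True by simp
next
  case False
  then have "Q y v = 0" by (intro Q_eq_0) auto
  then show ?thesis by simp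
qed

lemma integrable_Q: "integrable lborel (Q y)"
proof (rule integrable_interval[where a = \<alpha> and b = \<beta> and c = "1 / ((2 * \<alpha>)\<^sup>2)\<^sup>2"])
  show "Q y \<in> borel_measurable borel" unfolding Q_def by measurable
  show "\<bar>Q y v\<bar> \<le> 1 / ((2 * \<alpha>)\<^sup>2)\<^sup>2" if "v \<in> {\<alpha>..\<beta>}" for v
    using Q_le[of y v] Q_nonneg[of y v] that by simp
qed (auto intro: Q_eq_0)

lemma integrable_integral_Q: "integrable lborel (\<lambda>y. \<integral>v. Q y v \<partial>lborel)"
proof (rule integrable_interval[where a = \<alpha> and b = \<beta>])
  show "(\<lambda>y. \<integral>v. Q y v \<partial>lborel) \<in> borel_measurable borel"
    by (rule lborel.borel_measurable_lebesgue_integral) simp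
  have ii: "integrable lborel (\<lambda>v. 1 / ((2 * \<alpha>)\<^sup>2)\<^sup>2 * indicator {\<alpha>..\<beta>} v :: real)"
    by (intro integrable_mult_right integrable_real_indicator) (auto simp: emeasure_lborel_Icc_eq)
  show "\<bar>\<integral>v. Q y v \<partial>lborel\<bar> \<le> (\<integral>v. 1 / ((2 * \<alpha>)\<^sup>2)\<^sup>2 * indicator {\<alpha>..\<beta>} v \<partial>lborel)" for y
  proof -
    have "0 \<le> (\<integral>v. Q y v \<partial>lborel)" by (intro Bochner_Integration.integral_nonneg) (simp add: Q_nonneg)
    moreover have "(\<integral>v. Q y v \<partial>lborel) \<le> (\<integral>v. 1 / ((2 * \<alpha>)\<^sup>2)\<^sup>2 * indicator {\<alpha>..\<beta>} v \<partial>lborel)"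
      by (intro integral_mono integrable_Q ii) (rule Q_le)
    ultimately show ?thesis by simp
  qed
  show "(\<integral>v. Q y v \<partial>lborel) = 0" if "y \<notin> {\<alpha>..\<beta>}" for y
    using that by (simp add: Q_eq_0)
qed

lemma intensity_eq: "intensity w = 1 / (4 * pi) * (\<integral>y. W y / y\<^sup>2 \<partial>lborel)"
  unfolding intensity_def set_lebesgue_integral_def
  by (simp add: W_def mult.commute)

text \<open>On the support of \<open>W\<close> the weight \<open>1 / y^2\<close> is at least
  \<open>1 / \<beta>^2\<close>, so the intensity inherits positivity from the integral of
  \<open>w\<close>.\<close>

lemma intensity_pos: "0 < intensity w"
proof -
  have "integral\<^sup>L lborel W / \<beta>\<^sup>2 = (\<integral>y. W y / \<beta>\<^sup>2 \<partial>lborel)" by simp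
  also have "\<dots> \<le> (\<integral>y. W y / y\<^sup>2 \<partial>lborel)"
  proof (intro integral_mono integrable_W_div integrable_divide integrable_W)
    fix y
    show "W y / \<beta>\<^sup>2 \<le> W y / y\<^sup>2"
    proof (cases "y \<in> {\<alpha>..\<beta>}")
      case True
      then have "y\<^sup>2 \<le> \<beta>\<^sup>2" using \<alpha> by (intro power_mono) auto
      then show ?thesis using True \<alpha> W_nonneg[of y] by (intro divide_left_mono) auto
    qed (simp add: W_eq_0)
  qed
  moreover have "0 < integral\<^sup>L lborel W / \<beta>\<^sup>2" using integral_W_pos \<alpha> \<alpha>\<beta> by simp
  ultimately show ?thesis unfolding intensity_eq by simp
qed

lemma rho2_0_eq:
  "rho2 w 0 = (\<integral>y. W y / y\<^sup>2 \<partial>lborel)\<^sup>2 / (16 * pi\<^sup>2) - (\<integral>y. \<integral>v. Q y v \<partial>lborel \<partial>lborel) / pi\<^sup>2"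
proof -
  have "(LINT y:{0<..}|lborel. LINT v:{0<..}|lborel. w y * w v / (0\<^sup>2 + (y + v)\<^sup>2)\<^sup>2) =
      (\<integral>y. \<integral>v. Q y v \<partial>lborel \<partial>lborel)"
    unfolding set_lebesgue_integral_def
  proof (rule Bochner_Integration.integral_cong[OF refl])
    fix y
    have "indicator {0<..} y *\<^sub>R (\<integral>v. indicator {0<..} v *\<^sub>R (w y * w v / (0\<^sup>2 + (y + v)\<^sup>2)\<^sup>2) \<partial>lborel) =
        (\<integral>v. indicator {0<..} y * (indicator {0<..} v *\<^sub>R (w y * w v / (0\<^sup>2 + (y + v)\<^sup>2)\<^sup>2)) \<partial>lborel)"
      unfolding real_scaleR_def by (rule integral_mult_right_zero[symmetric])
    also have "\<dots> = (\<integral>v. Q y v \<partial>lborel)"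
      by (rule Bochner_Integration.integral_cong) (auto simp: Q_def W_def)
    finally show "indicator {0<..} y *\<^sub>R (\<integral>v. indicator {0<..} v *\<^sub>R (w y * w v / (0\<^sup>2 + (y + v)\<^sup>2)\<^sup>2) \<partial>lborel) =
        (\<integral>v. Q y v \<partial>lborel)" .
  qed
  then show ?thesis
    unfolding rho2_def intensity_eq by (simp add: power_divide power_mult_distrib)
qed

text \<open>The density of two retained points at heights \<open>y\<close> and \<open>v\<close>
  above the same abscissa. Integrating out the heights gives \<open>rho2 w 0\<close>.\<close>

definition F :: "real \<Rightarrow> real \<Rightarrow> real" where "F y v = W y * W v * pair_density 0 y v"

lemma F_eq: "F y v = W y / y\<^sup>2 * (W v / v\<^sup>2) / (16 * pi\<^sup>2) - Q y v / pi\<^sup>2"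
  by (simp add: F_def pair_density_def Q_def right_diff_distrib ac_simps)

lemma F_nonneg: "0 \<le> F y v"
proof (cases "y \<in> {\<alpha>..\<beta>} \<and> v \<in> {\<alpha>..\<beta>}")
  case True
  then show ?thesis unfolding F_def using \<alpha> W_nonneg
    by (intro mult_nonneg_nonneg pair_density_0_nonneg) auto
next
  case False
  then show ?thesis by (auto simp: F_def W_eq_0)
qed

lemma F_measurable [measurable]: "(\<lambda>(y, v). F y v) \<in> borel_measurable (borel \<Otimes>\<^sub>M borel)"
  unfolding F_def pair_density_def split_beta by measurable

text \<open>\<open>rho2\<close> is a difference of Bochner integrals, while the moments are extended
  nonnegative integrals. Bounded support makes every piece integrable, and \<open>F \<ge> 0\<close>
  allows the passage from one kind to the other.\<close>

lemma nn_integral_F: "(\<integral>\<^sup>+y. \<integral>\<^sup>+v. ennreal (F y v) \<partial>lborel \<partial>lborel) = ennreal (rho2 w 0)"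
  and rho2_0_nonneg: "0 \<le> rho2 w 0"
proof -
  define u where "u y = W y / y\<^sup>2" for y
  define m where "m = integral\<^sup>L lborel u"
  define q where "q y = (\<integral>v. Q y v \<partial>lborel)" for y
  have u: "integrable lborel u" and q: "integrable lborel q"
    using integrable_W_div integrable_integral_Q by (simp_all add: u_def[abs_def] q_def[abs_def])
  have F_u: "F y v = u y * u v / (16 * pi\<^sup>2) - Q y v / pi\<^sup>2" for y v
    by (simp add: F_eq u_def)
  have iF: "integrable lborel (F y)" for y
    unfolding F_u[abs_def] using u integrable_Q
    by (intro Bochner_Integration.integrable_diff integrable_divide integrable_mult_right) auto
  have inner: "(\<integral>v. F y v \<partial>lborel) = u y * m / (16 * pi\<^sup>2) - q y / pi\<^sup>2" for y
  proof -
    have "(\<integral>v. F y v \<partial>lborel) = (\<integral>v. u y * u v / (16 * pi\<^sup>2) \<partial>lborel) - (\<integral>v. Q y v / pi\<^sup>2 \<partial>lborel)"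
      unfolding F_u by (rule Bochner_Integration.integral_diff) (use u integrable_Q in auto)
    then show ?thesis by (simp add: m_def q_def)
  qed
  have io: "integrable lborel (\<lambda>y. \<integral>v. F y v \<partial>lborel)"
    unfolding inner using u q by auto
  have outer: "(\<integral>y. \<integral>v. F y v \<partial>lborel \<partial>lborel) = rho2 w 0"
  proof -
    have "(\<integral>y. \<integral>v. F y v \<partial>lborel \<partial>lborel) =
        (\<integral>y. u y * m / (16 * pi\<^sup>2) \<partial>lborel) - (\<integral>y. q y / pi\<^sup>2 \<partial>lborel)"
      unfolding inner by (rule Bochner_Integration.integral_diff) (use u q in auto)
    also have "\<dots> = m * m / (16 * pi\<^sup>2) - integral\<^sup>L lborel q / pi\<^sup>2" by (simp add: m_def)
    also have "\<dots> = rho2 w 0"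
      by (simp add: rho2_0_eq m_def u_def[abs_def] q_def[abs_def] power2_eq_square)
    finally show ?thesis .
  qed
  have nn: "0 \<le> (\<integral>v. F y v \<partial>lborel)" for y
    by (intro Bochner_Integration.integral_nonneg) (simp add: F_nonneg)
  have "(\<integral>\<^sup>+y. \<integral>\<^sup>+v. ennreal (F y v) \<partial>lborel \<partial>lborel) = (\<integral>\<^sup>+y. ennreal (\<integral>v. F y v \<partial>lborel) \<partial>lborel)"
    by (intro nn_integral_cong nn_integral_eq_integral iF) (simp_all add: F_nonneg)
  also have "\<dots> = ennreal (\<integral>y. \<integral>v. F y v \<partial>lborel \<partial>lborel)"
    by (intro nn_integral_eq_integral io) (simp_all add: nn)
  finally show "(\<integral>\<^sup>+y. \<integral>\<^sup>+v. ennreal (F y v) \<partial>lborel \<partial>lborel) = ennreal (rho2 w 0)" unfolding outer .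
  have "0 \<le> (\<integral>y. \<integral>v. F y v \<partial>lborel \<partial>lborel)" by (rule Bochner_Integration.integral_nonneg) (rule nn)
  then show "0 \<le> rho2 w 0" unfolding outer .
qed

text \<open>If the integral were zero, \<open>F\<close> would vanish almost everywhere. But for a
  height \<open>y\<close> with \<open>W y > 0\<close>, \<open>F y v\<close> is positive at every
  \<open>v \<noteq> y\<close> with \<open>W v > 0\<close>; a single point is null, so
  \<open>W\<close> would vanish almost everywhere, against its positive integral.\<close>

lemma rho2_0_pos: "0 < rho2 w 0"
proof (rule ccontr)
  assume "\<not> 0 < rho2 w 0"
  then have "(\<integral>\<^sup>+y. \<integral>\<^sup>+v. ennreal (F y v) \<partial>lborel \<partial>lborel) = 0"
    using rho2_0_nonneg nn_integral_F by simp
  moreover have "(\<lambda>y. \<integral>\<^sup>+v. ennreal (F y v) \<partial>lborel) \<in> borel_measurable lborel"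
    by (rule lborel.borel_measurable_nn_integral) simp
  ultimately have ae: "AE y in lborel. (\<integral>\<^sup>+v. ennreal (F y v) \<partial>lborel) = 0"
    by (subst (asm) nn_integral_0_iff_AE) auto
  have nW: "\<not> (AE v in lborel. W v = 0)"
  proof
    assume "AE v in lborel. W v = 0"
    then have "integral\<^sup>L lborel W = 0" by (rule integral_eq_zero_AE)
    then show False using integral_W_pos by simp
  qed
  have "W y = 0" if y: "(\<integral>\<^sup>+v. ennreal (F y v) \<partial>lborel) = 0" for y
  proof (rule ccontr)
    assume Wy: "W y \<noteq> 0"
    then have "y > 0" using W_eq_0[of y] \<alpha> by (cases "y \<in> {\<alpha>..\<beta>}") auto
    have "(\<lambda>v. ennreal (F y v)) \<in> borel_measurable lborel"
      unfolding F_def pair_density_def by measurable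
    with y have "AE v in lborel. ennreal (F y v) = 0" by (subst (asm) nn_integral_0_iff_AE) auto
    then have "AE v in lborel. W v = 0"
      using AE_lborel_singleton[of y]
    proof eventually_elim
      case (elim v)
      show "W v = 0"
      proof (rule ccontr)
        assume Wv: "W v \<noteq> 0"
        then have "v > 0" using W_eq_0[of v] \<alpha> by (cases "v \<in> {\<alpha>..\<beta>}") auto
        then have "0 < F y v"
          unfolding F_def using pair_density_0_pos[of y v] \<open>y > 0\<close> elim(2) Wy Wv W_nonneg[of y] W_nonneg[of v]
          by (intro mult_pos_pos) auto
        then show False using elim(1) by simp
      qed
    qed
    then show False using nW by simp
  qed
  with ae have "AE y in lborel. W y = 0" by (auto elim: eventually_mono)
  then show False using nW by simp
qed

end

section \<open>Half-plane integrals in horizontal and vertical coordinates\<close>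

abbreviation half_plane_measure :: "complex measure" where
  "half_plane_measure \<equiv> restrict_space lborel upper_half_plane"

lemma nn_integral_half_plane_product:
  assumes [measurable]: "f \<in> borel_measurable borel" "g \<in> borel_measurable borel"
    and g: "\<And>y. y \<le> 0 \<Longrightarrow> g y = 0"
  shows "(\<integral>\<^sup>+z. f (Re z) * g (Im z) \<partial>half_plane_measure) = (\<integral>\<^sup>+x. f x \<partial>lborel) * (\<integral>\<^sup>+y. g y \<partial>lborel)"
proof -
  have "(\<integral>\<^sup>+z. f (Re z) * g (Im z) \<partial>half_plane_measure) =
      (\<integral>\<^sup>+z. f (Re z) * g (Im z) * indicator upper_half_plane z \<partial>lborel)"
    using upper_half_plane_borel by (subst nn_integral_restrict_space) auto
  also have "\<dots> = (\<integral>\<^sup>+z. f (Re z) * g (Im z) \<partial>lborel)"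
    using g by (intro nn_integral_cong) (auto simp: upper_half_plane_def indicator_def not_less)
  also have "\<dots> = (\<integral>\<^sup>+x. \<integral>\<^sup>+y. f x * g y \<partial>lborel \<partial>lborel)"
    by (subst nn_integral_lborel_complex) auto
  also have "\<dots> = (\<integral>\<^sup>+x. f x \<partial>lborel) * (\<integral>\<^sup>+y. g y \<partial>lborel)"
    by (simp add: nn_integral_cmult nn_integral_multc)
  finally show ?thesis .
qed

lemma nn_integral_of_bool_shift:
  assumes "0 \<le> t"
  shows "(\<integral>\<^sup>+x. of_bool (x - s \<in> {0<..t}) \<partial>lborel) = ennreal t"
proof -
  have "(\<integral>\<^sup>+x. of_bool (x - s \<in> {0<..t}) \<partial>lborel) = (\<integral>\<^sup>+x. indicator {s<..s + t} x \<partial>lborel)"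
    by (intro nn_integral_cong) (auto simp: indicator_def)
  also have "\<dots> = ennreal t" using assms by simp
  finally show ?thesis .
qed

lemma nn_integral_of_bool_unit: "(\<integral>\<^sup>+x. of_bool (x \<in> {0..1 :: real}) \<partial>lborel) = 1"
proof -
  have "(\<integral>\<^sup>+x. of_bool (x \<in> {0..1 :: real}) \<partial>lborel) = (\<integral>\<^sup>+x. indicator {0..1 :: real} x \<partial>lborel)"
    by (intro nn_integral_cong) (auto simp: indicator_def)
  then show ?thesis by simp
qed

text \<open>As \<open>h\<close> sees only heights, the horizontal integrals factor out: the window
  of length \<open>t\<close> right of \<open>Re a\<close> contributes \<open>t\<close> whatever
  \<open>Re a\<close> is, and the unit window contributes 1.\<close>

lemma nn_integral_half_plane_pairs:
  assumes h: "(\<lambda>(y, v). h y v) \<in> borel_measurable (borel \<Otimes>\<^sub>M borel)"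
    and h0: "\<And>y v. y \<le> 0 \<or> v \<le> 0 \<Longrightarrow> h y v = 0" and t: "0 \<le> t"
  shows "(\<integral>\<^sup>+a. \<integral>\<^sup>+b. of_bool (Re a \<in> {0..1}) * of_bool (Re b - Re a \<in> {0<..t}) * h (Im a) (Im b)
      \<partial>half_plane_measure \<partial>half_plane_measure) = ennreal t * (\<integral>\<^sup>+y. \<integral>\<^sup>+v. h y v \<partial>lborel \<partial>lborel)"
proof -
  have hy: "h y \<in> borel_measurable borel" for y using measurable_Pair2[OF h, of y] by simp
  have H: "(\<lambda>y. \<integral>\<^sup>+v. h y v \<partial>lborel) \<in> borel_measurable borel"
    using h by (intro lborel.borel_measurable_nn_integral) simp
  have "(\<integral>\<^sup>+b. of_bool (Re a \<in> {0..1}) * of_bool (Re b - Re a \<in> {0<..t}) * h (Im a) (Im b) \<partial>half_plane_measure) =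
      of_bool (Re a \<in> {0..1}) * (ennreal t * (\<integral>\<^sup>+v. h (Im a) v \<partial>lborel))" for a
    using nn_integral_half_plane_product[of "\<lambda>x. of_bool (Re a \<in> {0..1}) * of_bool (x - Re a \<in> {0<..t})" "h (Im a)"]
    by (simp add: hy h0 nn_integral_cmult nn_integral_of_bool_shift[OF t] mult.assoc del: greaterThanAtMost_iff)
  then have "(\<integral>\<^sup>+a. \<integral>\<^sup>+b. of_bool (Re a \<in> {0..1}) * of_bool (Re b - Re a \<in> {0<..t}) * h (Im a) (Im b)
      \<partial>half_plane_measure \<partial>half_plane_measure) =
      (\<integral>\<^sup>+a. of_bool (Re a \<in> {0..1}) * (ennreal t * (\<integral>\<^sup>+v. h (Im a) v \<partial>lborel)) \<partial>half_plane_measure)"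
    by simp
  also have "\<dots> = (\<integral>\<^sup>+x. of_bool (x \<in> {0..1 :: real}) \<partial>lborel) * (\<integral>\<^sup>+y. ennreal t * (\<integral>\<^sup>+v. h y v \<partial>lborel) \<partial>lborel)"
    using H h0 by (intro nn_integral_half_plane_product) auto
  also have "\<dots> = ennreal t * (\<integral>\<^sup>+y. \<integral>\<^sup>+v. h y v \<partial>lborel \<partial>lborel)"
    using H unfolding nn_integral_of_bool_unit by (simp add: nn_integral_cmult)
  finally show ?thesis .
qed

section \<open>Moments of the thinned process\<close>

definition half_plane_density :: "nat \<Rightarrow> (nat \<Rightarrow> complex) \<Rightarrow> ennreal" where
  "half_plane_density k x = ennreal (Re (Determinant.det (Matrix.mat k k (\<lambda>(i, j). K_H (x i) (x j)))))"

lemma sets_PiM_half_plane: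
  "sets (PiM {..<k} (\<lambda>_. half_plane_measure)) = sets (PiM {..<k} (\<lambda>_. restrict_space borel upper_half_plane))"
  by (intro sets_PiM_cong) (auto simp: sets_restrict_space)

lemma measurable_component_half_plane:
  assumes "i < k"
  shows "(\<lambda>x. x i) \<in> borel_measurable (PiM {..<k} (\<lambda>_. half_plane_measure))"
proof -
  have "(\<lambda>x. x i) \<in> measurable (PiM {..<k} (\<lambda>_. restrict_space borel upper_half_plane)) (restrict_space borel upper_half_plane)"
    using assms by (intro measurable_component_singleton) auto
  then have "(\<lambda>x. x i) \<in> borel_measurable (PiM {..<k} (\<lambda>_. restrict_space borel upper_half_plane))"
    by (simp add: measurable_restrict_space2_iff)
  then show ?thesis by (simp cong: measurable_cong_sets add: sets_PiM_half_plane)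
qed

lemma measurable_half_plane_density:
  "half_plane_density k \<in> borel_measurable (PiM {..<k} (\<lambda>_. half_plane_measure))"
proof -
  have "(\<lambda>x. K_H (x i) (x j)) \<in> borel_measurable (PiM {..<k} (\<lambda>_. half_plane_measure))"
    if [simp]: "i < k" "j < k" for i j
  proof -
    note [measurable] = measurable_component_half_plane[OF that(1)] measurable_component_half_plane[OF that(2)]
    have [measurable]: "cnj \<in> borel_measurable borel"
      by (intro borel_measurable_continuous_onI continuous_intros)
    show ?thesis unfolding K_H_def by measurable
  qed
  then have "(\<lambda>x. Determinant.det (Matrix.mat k k ((\<lambda>x (i, j). K_H (x i) (x j)) x)))
      \<in> borel_measurable (PiM {..<k} (\<lambda>_. half_plane_measure))"
    by (intro measurable_det_mat) simp
  then show ?thesis unfolding half_plane_density_def[abs_def] by simp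
qed

lemma measurable_near_pair: "near_pair t \<in> borel_measurable (PiM {..<2} (\<lambda>_. half_plane_measure))"
proof -
  note [measurable] = measurable_component_half_plane[of 0 2, simplified] measurable_component_half_plane[of 1 2, simplified]
  show ?thesis unfolding near_pair_def[abs_def] by measurable
qed

lemma measurable_near_triple: "near_triple t \<in> borel_measurable (PiM {..<3} (\<lambda>_. half_plane_measure))"
proof -
  note [measurable] = measurable_component_half_plane[of 0 3, simplified] measurable_component_half_plane[of 1 3, simplified]
    measurable_component_half_plane[of 2 3, simplified]
  show ?thesis unfolding near_triple_def[abs_def] by measurable
qed

lemma sigma_finite_half_plane: "sigma_finite_measure half_plane_measure"
  using upper_half_plane_borel by (intro sigma_finite_measure_restrict_space) (auto intro: lborel.sigma_finite_measure_axioms)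

lemma half_plane_density_2:
  assumes "a \<in> upper_half_plane" "b \<in> upper_half_plane"
  shows "half_plane_density 2 ((\<lambda>_. undefined)(0 := a, 1 := b)) = ennreal (pair_density (Re b - Re a) (Im a) (Im b))"
proof -
  have "Matrix.mat 2 2 (\<lambda>(i, j). K_H (((\<lambda>_. undefined)(0 := a, 1 := b)) i) (((\<lambda>_. undefined)(0 := a, 1 := b)) j)) =
      Matrix.mat 2 2 (\<lambda>(i, j). K_H ([a, b] ! i) ([a, b] ! j))"
    by (intro eq_matI) (auto simp: less_2_cases_iff)
  then show ?thesis
    using assms unfolding half_plane_density_def upper_half_plane_def
    by (simp only: mem_Collect_eq Re_det_K_H_2)
qed

lemma half_plane_density_3_le:
  assumes "0 < \<alpha>" "\<And>i. i < 3 \<Longrightarrow> \<alpha> \<le> Im (x i)"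
  shows "half_plane_density 3 x \<le> ennreal (6 * (1 / (4 * pi * \<alpha>\<^sup>2)) ^ 3)"
proof -
  have "Re (Determinant.det (Matrix.mat 3 3 (\<lambda>(i, j). K_H (x i) (x j)))) \<le>
      norm (Determinant.det (Matrix.mat 3 3 (\<lambda>(i, j). K_H (x i) (x j))))"
    by (rule complex_Re_le_cmod)
  also have "\<dots> \<le> fact 3 * (1 / (4 * pi * \<alpha>\<^sup>2)) ^ 3"
    using assms by (intro norm_det_mat_le) (auto intro!: norm_K_H_le)
  finally show ?thesis
    unfolding half_plane_density_def by (intro ennreal_leI) (simp add: fact_numeral)
qed

section \<open>Estimates for the pair and triple integrals\<close>

context retention
begin

text \<open>By \<open>moment_eq\<close> this is the expected number of near pairs of retained
  points; \<open>triple_moment\<close> is its analogue for near triples.\<close>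

definition pair_moment :: "real \<Rightarrow> ennreal" where
  "pair_moment t = (\<integral>\<^sup>+x. near_pair t x * (\<Prod>i<2. ennreal (w (Im (x i)))) * half_plane_density 2 x
     \<partial>PiM {..<2} (\<lambda>_. half_plane_measure))"

definition triple_moment :: "real \<Rightarrow> ennreal" where
  "triple_moment t = (\<integral>\<^sup>+x. near_triple t x * (\<Prod>i<3. ennreal (w (Im (x i)))) * half_plane_density 3 x
     \<partial>PiM {..<3} (\<lambda>_. half_plane_measure))"

lemma measurable_w_Im: "(\<lambda>z. w (Im z)) \<in> borel_measurable (restrict_space borel upper_half_plane)"
proof -
  have "(\<lambda>z. W (Im z)) \<in> borel_measurable (restrict_space borel upper_half_plane)"
    by (rule measurable_restrict_space1) simp
  then show ?thesis
    by (rule measurable_cong[THEN iffD2, rotated]) (simp add: space_restrict_space upper_half_plane_def W_pos)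
qed

lemma measurable_prod_w:
  fixes k :: nat
  shows "(\<lambda>x. \<Prod>i<k. ennreal (w (Im (x i)))) \<in> borel_measurable (PiM {..<k} (\<lambda>_. half_plane_measure))"
proof -
  have "(\<lambda>x. w (Im (x i))) \<in> borel_measurable (PiM {..<k} (\<lambda>_. restrict_space borel upper_half_plane))"
    if "i \<in> {..<k}" for i
    by (rule measurable_compose[OF measurable_component_singleton[OF that] measurable_w_Im])
  then have [measurable]: "(\<lambda>x. w (Im (x i))) \<in> borel_measurable (PiM {..<k} (\<lambda>_. half_plane_measure))"
    if "i \<in> {..<k}" for i
    using that by (simp cong: measurable_cong_sets add: sets_PiM_half_plane)
  show ?thesis by measurable
qed

lemma pair_moment_eq:
  "pair_moment t = (\<integral>\<^sup>+a. \<integral>\<^sup>+b. of_bool (Re a \<in> {0..1}) * of_bool (Re b - Re a \<in> {0<..t}) *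
     ennreal (W (Im a) * W (Im b) * pair_density (Re b - Re a) (Im a) (Im b))
     \<partial>half_plane_measure \<partial>half_plane_measure)"
proof -
  have "pair_moment t = (\<integral>\<^sup>+a. \<integral>\<^sup>+b.
      (\<lambda>x. near_pair t x * (\<Prod>i<2. ennreal (w (Im (x i)))) * half_plane_density 2 x) ((\<lambda>_. undefined)(0 := a, 1 := b))
      \<partial>half_plane_measure \<partial>half_plane_measure)"
    unfolding pair_moment_def
    using measurable_near_pair measurable_prod_w[of 2] measurable_half_plane_density[of 2]
    by (intro nn_integral_PiM_2 sigma_finite_half_plane) simp
  also have "\<dots> = (\<integral>\<^sup>+a. \<integral>\<^sup>+b. of_bool (Re a \<in> {0..1}) * of_bool (Re b - Re a \<in> {0<..t}) *
     ennreal (W (Im a) * W (Im b) * pair_density (Re b - Re a) (Im a) (Im b))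
     \<partial>half_plane_measure \<partial>half_plane_measure)"
  proof (intro nn_integral_cong)
    fix a b assume "a \<in> space half_plane_measure" "b \<in> space half_plane_measure"
    then have ab: "a \<in> upper_half_plane" "b \<in> upper_half_plane" by (auto simp: space_restrict_space)
    then have pos: "0 < Im a" "0 < Im b" by (auto simp: upper_half_plane_def)
    let ?x = "(\<lambda>_. undefined)(0 := a, 1 := b) :: nat \<Rightarrow> complex"
    have "near_pair t ?x = of_bool (Re a \<in> {0..1}) * of_bool (Re b - Re a \<in> {0<..t})"
      by (simp add: near_pair_def of_bool_conj)
    moreover have "(\<Prod>i<2. ennreal (w (Im (?x i)))) = ennreal (W (Im a)) * ennreal (W (Im b))"
      using pos by (simp add: numeral_2_eq_2 W_pos)
    moreover have "0 \<le> pair_density (Re b - Re a) (Im a) (Im b)"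
      using pair_density_0_nonneg[OF pos] pair_density_ge[OF pos] by (rule order.trans)
    ultimately show "near_pair t ?x * (\<Prod>i<2. ennreal (w (Im (?x i)))) * half_plane_density 2 ?x =
        of_bool (Re a \<in> {0..1}) * of_bool (Re b - Re a \<in> {0<..t}) *
        ennreal (W (Im a) * W (Im b) * pair_density (Re b - Re a) (Im a) (Im b))"
      unfolding half_plane_density_2[OF ab] by (simp add: ennreal_mult W_nonneg mult.assoc)
  qed
  finally show ?thesis .
qed

lemma pair_moment_ge:
  assumes "0 \<le> t"
  shows "ennreal (rho2 w 0 * t) \<le> pair_moment t"
proof -
  have "ennreal (rho2 w 0 * t) = ennreal t * (\<integral>\<^sup>+y. \<integral>\<^sup>+v. ennreal (F y v) \<partial>lborel \<partial>lborel)"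
    unfolding nn_integral_F using assms rho2_0_nonneg by (simp add: ennreal_mult mult.commute)
  also have "\<dots> = (\<integral>\<^sup>+a. \<integral>\<^sup>+b. of_bool (Re a \<in> {0..1}) * of_bool (Re b - Re a \<in> {0<..t}) *
     ennreal (F (Im a) (Im b)) \<partial>half_plane_measure \<partial>half_plane_measure)"
  proof (intro nn_integral_half_plane_pairs[symmetric])
    show "ennreal (F y v) = 0" if "y \<le> 0 \<or> v \<le> 0" for y v
      using that \<alpha> by (auto simp: F_def W_eq_0)
  qed (use assms in simp_all)
  also have "\<dots> \<le> pair_moment t"
    unfolding pair_moment_eq F_def
  proof (intro nn_integral_mono mult_left_mono ennreal_leI)
    fix a b assume "a \<in> space half_plane_measure" "b \<in> space half_plane_measure"
    then show "pair_density 0 (Im a) (Im b) \<le> pair_density (Re b - Re a) (Im a) (Im b)"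
      by (intro pair_density_ge) (auto simp: space_restrict_space upper_half_plane_def)
  qed (auto simp: W_nonneg)
  finally show ?thesis .
qed

lemma nn_integral_W_le: "(\<integral>\<^sup>+y. ennreal (W y) \<partial>lborel) \<le> ennreal (\<beta> - \<alpha>)"
proof -
  have "(\<integral>\<^sup>+y. ennreal (W y) \<partial>lborel) \<le> (\<integral>\<^sup>+y. indicator {\<alpha>..\<beta>} y \<partial>lborel)"
    by (intro nn_integral_mono) (auto simp: indicator_def W_eq_0 W_le_1)
  then show ?thesis using \<alpha>\<beta> by simp
qed

text \<open>The density error \<open>C * t\<close>, weighted by \<open>W\<close> at both heights,
  integrates to at most \<open>C * t * (\<beta> - \<alpha>)^2\<close>; the horizontal window adds
  the second factor \<open>t\<close>.\<close>

lemma pair_moment_le: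
  assumes t: "0 \<le> t" "t \<le> 1"
  shows "pair_moment t \<le> ennreal (rho2 w 0 * t + 2 / (pi\<^sup>2 * (2 * \<alpha>)^6) * (\<beta> - \<alpha>)\<^sup>2 * t\<^sup>2)"
proof -
  define C where "C = 2 / (pi\<^sup>2 * (2 * \<alpha>)^6)"
  have C: "0 \<le> C" using \<alpha> by (simp add: C_def)
  define h where "h y v = ennreal (F y v) + ennreal (C * t) * (ennreal (W y) * ennreal (W v))" for y v
  have hm: "(\<lambda>(y, v). h y v) \<in> borel_measurable (borel \<Otimes>\<^sub>M borel)"
    unfolding h_def F_def pair_density_def split_beta by measurable
  have Fm: "(\<lambda>v. ennreal (F y v)) \<in> borel_measurable lborel" for y
    unfolding F_def pair_density_def by measurable
  have Fm2: "(\<lambda>y. \<integral>\<^sup>+v. ennreal (F y v) \<partial>lborel) \<in> borel_measurable lborel"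
    by (rule lborel.borel_measurable_nn_integral) simp
  have "pair_moment t \<le> (\<integral>\<^sup>+a. \<integral>\<^sup>+b. of_bool (Re a \<in> {0..1}) * of_bool (Re b - Re a \<in> {0<..t}) *
     h (Im a) (Im b) \<partial>half_plane_measure \<partial>half_plane_measure)"
    unfolding pair_moment_eq
  proof (intro nn_integral_mono)
    fix a b
    show "of_bool (Re a \<in> {0..1}) * of_bool (Re b - Re a \<in> {0<..t}) *
        ennreal (W (Im a) * W (Im b) * pair_density (Re b - Re a) (Im a) (Im b)) \<le>
        of_bool (Re a \<in> {0..1}) * of_bool (Re b - Re a \<in> {0<..t}) * h (Im a) (Im b)"
    proof (cases "Re b - Re a \<in> {0<..t} \<and> Im a \<in> {\<alpha>..\<beta>} \<and> Im b \<in> {\<alpha>..\<beta>}")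
      case True
      have "pair_density (Re b - Re a) (Im a) (Im b) \<le> pair_density 0 (Im a) (Im b) + C * t"
        unfolding C_def using True t \<alpha> by (intro pair_density_le) auto
      then have "W (Im a) * W (Im b) * pair_density (Re b - Re a) (Im a) (Im b) \<le>
          W (Im a) * W (Im b) * (pair_density 0 (Im a) (Im b) + C * t)"
        by (intro mult_left_mono) (auto simp: W_nonneg)
      also have "\<dots> = F (Im a) (Im b) + C * t * (W (Im a) * W (Im b))"
        by (simp add: F_def algebra_simps)
      finally have "ennreal (W (Im a) * W (Im b) * pair_density (Re b - Re a) (Im a) (Im b)) \<le> h (Im a) (Im b)"
        using C t unfolding h_def
        by (simp add: F_nonneg W_nonneg flip: ennreal_mult ennreal_plus)
      then show ?thesis by (intro mult_left_mono) auto
    next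
      case False
      then show ?thesis by (auto simp: W_eq_0)
    qed
  qed
  also have "\<dots> = ennreal t * (\<integral>\<^sup>+y. \<integral>\<^sup>+v. h y v \<partial>lborel \<partial>lborel)"
    using \<alpha> t by (intro nn_integral_half_plane_pairs hm) (auto simp: h_def F_def W_eq_0)
  also have "(\<integral>\<^sup>+y. \<integral>\<^sup>+v. h y v \<partial>lborel \<partial>lborel) = (\<integral>\<^sup>+y. (\<integral>\<^sup>+v. ennreal (F y v) \<partial>lborel) +
      ennreal (C * t) * (ennreal (W y) * (\<integral>\<^sup>+v. ennreal (W v) \<partial>lborel)) \<partial>lborel)"
    unfolding h_def using Fm by (intro nn_integral_cong) (simp add: nn_integral_add nn_integral_cmult)
  also have "\<dots> = ennreal (rho2 w 0) +
      ennreal (C * t) * ((\<integral>\<^sup>+v. ennreal (W v) \<partial>lborel) * (\<integral>\<^sup>+v. ennreal (W v) \<partial>lborel))"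
    using Fm2 by (simp add: nn_integral_add nn_integral_cmult nn_integral_multc nn_integral_F)
  also have "\<dots> \<le> ennreal (rho2 w 0) + ennreal (C * t) * (ennreal (\<beta> - \<alpha>) * ennreal (\<beta> - \<alpha>))"
    by (intro add_left_mono mult_left_mono mult_mono nn_integral_W_le) auto
  also have "ennreal t * \<dots> = ennreal (t * (rho2 w 0 + C * t * ((\<beta> - \<alpha>) * (\<beta> - \<alpha>))))"
    using C t \<alpha>\<beta> rho2_0_nonneg by (simp flip: ennreal_mult ennreal_plus)
  finally have "pair_moment t \<le> ennreal (t * (rho2 w 0 + C * t * ((\<beta> - \<alpha>) * (\<beta> - \<alpha>))))"
    by (simp add: mult_left_mono)
  also have "t * (rho2 w 0 + C * t * ((\<beta> - \<alpha>) * (\<beta> - \<alpha>))) = rho2 w 0 * t + C * (\<beta> - \<alpha>)\<^sup>2 * t\<^sup>2"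
    by (simp add: power2_eq_square algebra_simps)
  finally show ?thesis unfolding C_def .
qed

text \<open>Two horizontal windows give \<open>t^2\<close>, three heights give
  \<open>(\<beta> - \<alpha>)^3\<close>, and the remaining constant bounds the determinant, with
  \<open>6 = fact 3\<close>.\<close>

lemma triple_moment_le:
  assumes t: "0 \<le> t"
  shows "triple_moment t \<le> ennreal (6 * (1 / (4 * pi * \<alpha>\<^sup>2)) ^ 3 * (\<beta> - \<alpha>)^3 * t\<^sup>2)"
proof -
  define c where "c = 6 * (1 / (4 * pi * \<alpha>\<^sup>2)) ^ 3"
  have c: "0 \<le> c" by (simp add: c_def)
  let ?I = "indicator {\<alpha>..\<beta>} :: real \<Rightarrow> ennreal"
  let ?s = "\<lambda>a b. of_bool (Re b - Re a \<in> {0<..t}) * ?I (Im b)"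
  have strip: "(\<integral>\<^sup>+b. ?s a b \<partial>half_plane_measure) = ennreal (t * (\<beta> - \<alpha>))" for a :: complex
  proof -
    have "(\<integral>\<^sup>+b. ?s a b \<partial>half_plane_measure) =
        (\<integral>\<^sup>+x. of_bool (x - Re a \<in> {0<..t}) \<partial>lborel) * (\<integral>\<^sup>+y. ?I y \<partial>lborel)"
      using \<alpha> by (intro nn_integral_half_plane_product) auto
    then show ?thesis unfolding nn_integral_of_bool_shift[OF t] using t \<alpha>\<beta> by (simp add: ennreal_mult)
  qed
  have unit: "(\<integral>\<^sup>+a. of_bool (Re a \<in> {0..1}) * ?I (Im a) \<partial>half_plane_measure) = ennreal (\<beta> - \<alpha>)"
  proof -
    have "(\<integral>\<^sup>+a. of_bool (Re a \<in> {0..1}) * ?I (Im a) \<partial>half_plane_measure) =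
        (\<integral>\<^sup>+x. of_bool (x \<in> {0..1 :: real}) \<partial>lborel) * (\<integral>\<^sup>+y. ?I y \<partial>lborel)"
      using \<alpha> by (intro nn_integral_half_plane_product) auto
    then show ?thesis unfolding nn_integral_of_bool_unit using \<alpha>\<beta> by simp
  qed
  have Im_m: "Im \<in> borel_measurable half_plane_measure" "Re \<in> borel_measurable half_plane_measure"
    by (auto intro!: measurable_restrict_space1)
  have sm: "(\<lambda>b. ?s a b) \<in> borel_measurable half_plane_measure" for a
    using Im_m by measurable
  have um: "(\<lambda>a. of_bool (Re a \<in> {0..1}) * ?I (Im a)) \<in> borel_measurable half_plane_measure"
    using Im_m by measurable
  have "triple_moment t = (\<integral>\<^sup>+a. \<integral>\<^sup>+b. \<integral>\<^sup>+d.
      (\<lambda>x. near_triple t x * (\<Prod>i<3. ennreal (w (Im (x i)))) * half_plane_density 3 x)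
        ((\<lambda>_. undefined)(0 := a, 1 := b, 2 := d))
      \<partial>half_plane_measure \<partial>half_plane_measure \<partial>half_plane_measure)"
    unfolding triple_moment_def
    using measurable_near_triple measurable_prod_w[of 3] measurable_half_plane_density[of 3]
    by (intro nn_integral_PiM_3 sigma_finite_half_plane) simp
  also have "\<dots> \<le> (\<integral>\<^sup>+a. \<integral>\<^sup>+b. \<integral>\<^sup>+d. of_bool (Re a \<in> {0..1}) * ?I (Im a) * (?s a b * (?s a d * ennreal c))
      \<partial>half_plane_measure \<partial>half_plane_measure \<partial>half_plane_measure)"
  proof (intro nn_integral_mono)
    fix a b d assume "a \<in> space half_plane_measure" "b \<in> space half_plane_measure" "d \<in> space half_plane_measure"
    then have pos: "0 < Im a" "0 < Im b" "0 < Im d" by (auto simp: space_restrict_space upper_half_plane_def)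
    let ?x = "(\<lambda>_. undefined)(0 := a, 1 := b, 2 := d) :: nat \<Rightarrow> complex"
    have near: "near_triple t ?x = of_bool (Re a \<in> {0..1}) * of_bool (Re b - Re a \<in> {0<..t}) * of_bool (Re d - Re a \<in> {0<..t})"
      by (simp add: near_triple_def of_bool_conj)
    have prod: "(\<Prod>i<3. ennreal (w (Im (?x i)))) = ennreal (W (Im a)) * ennreal (W (Im b)) * ennreal (W (Im d))"
      using pos by (simp add: numeral_3_eq_3 numeral_2_eq_2 W_pos)
    show "near_triple t ?x * (\<Prod>i<3. ennreal (w (Im (?x i)))) * half_plane_density 3 ?x \<le>
        of_bool (Re a \<in> {0..1}) * ?I (Im a) * (?s a b * (?s a d * ennreal c))"
    proof (cases "Im a \<in> {\<alpha>..\<beta>} \<and> Im b \<in> {\<alpha>..\<beta>} \<and> Im d \<in> {\<alpha>..\<beta>}")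
      case True
      have "half_plane_density 3 ?x \<le> ennreal c"
        unfolding c_def using True \<alpha> by (intro half_plane_density_3_le) (auto simp: numeral_3_eq_3 less_Suc_eq)
      moreover have "(\<Prod>i<3. ennreal (w (Im (?x i)))) \<le> 1"
        unfolding prod by (intro mult_le_one) (auto simp: W_le_1)
      ultimately have "near_triple t ?x * (\<Prod>i<3. ennreal (w (Im (?x i)))) * half_plane_density 3 ?x \<le>
          near_triple t ?x * 1 * ennreal c"
        by (intro mult_mono) auto
      then show ?thesis using True unfolding near by (simp add: ac_simps)
    next
      case False
      then have zero: "(\<Prod>i<3. ennreal (w (Im (?x i)))) = 0" unfolding prod by (auto simp: W_eq_0)
      show ?thesis unfolding zero by simp
    qed
  qed
  also have "\<dots> = ennreal (\<beta> - \<alpha>) * (ennreal (t * (\<beta> - \<alpha>)) * (ennreal (t * (\<beta> - \<alpha>)) * ennreal c))"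
    using sm um
    by (simp add: nn_integral_cmult nn_integral_multc strip unit del: greaterThanAtMost_iff atLeastAtMost_iff)
  also have "\<dots> = ennreal (c * (\<beta> - \<alpha>)^3 * t\<^sup>2)"
    using c t \<alpha>\<beta> by (simp add: power2_eq_square power3_eq_cube ac_simps flip: ennreal_mult)
  finally show ?thesis unfolding c_def .
qed

lemma moment_eq:
  assumes det: "determinantal_process \<Omega> Z upper_half_plane K_H"
    and th: "independent_thinning \<Omega> Z M upper_half_plane (\<lambda>z. w (Im z))"
    and k: "1 \<le> k"
    and u: "u \<in> borel_measurable (PiM {..<k} (\<lambda>_. half_plane_measure))"
  shows "(\<integral>\<^sup>+\<omega>. \<integral>\<^sup>+x. u x * indicator {x. inj_on x {..<k}} x
        \<partial>count_space (PiE {..<k} (\<lambda>_. points (M \<omega>))) \<partial>\<Omega>) =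
    (\<integral>\<^sup>+x. u x * (\<Prod>i<k. ennreal (w (Im (x i)))) * half_plane_density k x \<partial>PiM {..<k} (\<lambda>_. half_plane_measure))"
proof (rule nn_integral_thinning_factorial_moment[OF upper_half_plane_borel _ exhaustion_upper_half_plane _
      measurable_half_plane_density _ th _ measurable_w_Im u])
  have "\<i> \<in> upper_half_plane" by (simp add: upper_half_plane_def)
  then show "upper_half_plane \<noteq> {}" by blast
  show "Z \<in> measurable \<Omega> (conf_space upper_half_plane)" using det by (simp add: determinantal_process_def)
  show "0 \<le> w (Im z) \<and> w (Im z) \<le> 1" if "z \<in> upper_half_plane" for z
    using that w_range by (auto simp: upper_half_plane_def)
  fix A assume "A \<in> sets (PiM {..<k} (\<lambda>_. half_plane_measure))"
  then show "factorial_moment \<Omega> Z k A = (\<integral>\<^sup>+x\<in>A. half_plane_density k x \<partial>PiM {..<k} (\<lambda>_. half_plane_measure))"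
    using det k unfolding determinantal_process_def half_plane_density_def by blast
qed

text \<open>Expectations of the pointwise comparison, where \<open>X\<close> may replace the
  projection of \<open>M\<close> because they agree almost surely.\<close>

lemma close_points_bounds:
  assumes det: "determinantal_process \<Omega> Z upper_half_plane K_H"
    and th: "independent_thinning \<Omega> Z M upper_half_plane (\<lambda>z. w (Im z))"
    and X: "projected_process \<Omega> M X"
  shows "(\<integral>\<^sup>+\<omega>. close_points t (X \<omega>) \<partial>\<Omega>) \<le> pair_moment t"
    and "pair_moment t \<le> (\<integral>\<^sup>+\<omega>. close_points t (X \<omega>) \<partial>\<Omega>) + triple_moment t"
proof -
  let ?U2 = "\<lambda>\<omega>. \<integral>\<^sup>+x. near_pair t x * indicator {x. inj_on x {..<2}} x \<partial>count_space (PiE {..<2} (\<lambda>_. points (M \<omega>)))"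
  let ?U3 = "\<lambda>\<omega>. \<integral>\<^sup>+x. near_triple t x * indicator {x. inj_on x {..<3}} x \<partial>count_space (PiE {..<3} (\<lambda>_. points (M \<omega>)))"
  have M: "M \<in> measurable \<Omega> (conf_space upper_half_plane)" using th by (simp add: independent_thinning_def)
  have Mc: "M \<omega> \<in> conf upper_half_plane" if "\<omega> \<in> space \<Omega>" for \<omega> using measurable_space[OF M that] by simp
  have Xm: "X \<in> measurable \<Omega> (conf_space UNIV)" and Xae: "AE \<omega> in \<Omega>. X \<omega> = distr (M \<omega>) borel Re"
    using X by (auto simp: projected_process_def)
  have cm: "(\<lambda>\<omega>. close_points t (X \<omega>)) \<in> borel_measurable \<Omega>"
    using measurable_compose[OF Xm measurable_close_points] .
  have U2: "(\<integral>\<^sup>+\<omega>. ?U2 \<omega> \<partial>\<Omega>) = pair_moment t"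
    unfolding pair_moment_def by (rule moment_eq[OF det th _ measurable_near_pair]) simp
  have U3: "(\<integral>\<^sup>+\<omega>. ?U3 \<omega> \<partial>\<Omega>) = triple_moment t"
    unfolding triple_moment_def by (rule moment_eq[OF det th _ measurable_near_triple]) simp
  \<comment> \<open>Splitting the integral of the sum below requires both summands to be
    measurable.\<close>
  have U3m: "?U3 \<in> borel_measurable \<Omega>"
  proof (rule measurable_nn_integral_tuples[OF upper_half_plane_borel _ exhaustion_upper_half_plane M,
        where u = "\<lambda>_ x. near_triple t x * indicator {x. inj_on x {..<3}} x"])
    have "\<i> \<in> upper_half_plane" by (simp add: upper_half_plane_def)
    then show "upper_half_plane \<noteq> {}" by blast
    have "near_triple t \<in> borel_measurable (PiM {..<3} (\<lambda>_. restrict_space borel upper_half_plane))"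
      using measurable_near_triple[of t] by (simp cong: measurable_cong_sets add: sets_PiM_half_plane)
    then have "(\<lambda>x. near_triple t x * indicator {x. inj_on x {..<3}} x)
        \<in> borel_measurable (PiM {..<3} (\<lambda>_. restrict_space borel upper_half_plane))"
      using measurable_inj_on_PiM[of 3 upper_half_plane] by (intro borel_measurable_times_ennreal) auto
    then show "(\<lambda>(a, x). near_triple t x * indicator {x. inj_on x {..<3}} x)
        \<in> borel_measurable (\<Omega> \<Otimes>\<^sub>M PiM {..<3} (\<lambda>_. restrict_space borel upper_half_plane))"
      by (rule measurable_compose[OF measurable_snd, THEN measurable_cong[THEN iffD2, rotated]]) auto
  qed
  have "(\<integral>\<^sup>+\<omega>. close_points t (X \<omega>) \<partial>\<Omega>) \<le> (\<integral>\<^sup>+\<omega>. ?U2 \<omega> \<partial>\<Omega>)"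
    using Xae AE_space
    by (intro nn_integral_mono_AE, eventually_elim) (simp add: close_points_projection(1)[OF Mc])
  then show "(\<integral>\<^sup>+\<omega>. close_points t (X \<omega>) \<partial>\<Omega>) \<le> pair_moment t" unfolding U2 .
  have "(\<integral>\<^sup>+\<omega>. ?U2 \<omega> \<partial>\<Omega>) \<le> (\<integral>\<^sup>+\<omega>. close_points t (X \<omega>) + ?U3 \<omega> \<partial>\<Omega>)"
    using Xae AE_space
    by (intro nn_integral_mono_AE, eventually_elim) (simp add: close_points_projection(2)[OF Mc])
  also have "\<dots> = (\<integral>\<^sup>+\<omega>. close_points t (X \<omega>) \<partial>\<Omega>) + (\<integral>\<^sup>+\<omega>. ?U3 \<omega> \<partial>\<Omega>)"
    by (rule nn_integral_add[OF cm U3m])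
  finally show "pair_moment t \<le> (\<integral>\<^sup>+\<omega>. close_points t (X \<omega>) \<partial>\<Omega>) + triple_moment t" unfolding U2 U3 .
qed

end

theorem theorem1p3:
  fixes \<alpha> \<beta> :: real and w :: "real \<Rightarrow> real"
    and \<Omega> :: "'w measure"
    and Z M :: "'w \<Rightarrow> complex measure" and X :: "'w \<Rightarrow> real measure"
    and P :: "real measure measure"
  assumes "0 < \<alpha>" and "\<alpha> < \<beta>"
    and "w \<in> retention_class \<alpha> \<beta>"
    and "prob_space \<Omega>"
    and "determinantal_process \<Omega> Z upper_half_plane K_H"
    and "independent_thinning \<Omega> Z M upper_half_plane (\<lambda>z. w (Im z))"
    and "projected_process \<Omega> M X"
    and "reduced_palm \<Omega> X (intensity w) P"
  shows "(\<lambda>t. measure P {\<mu> \<in> space P. first_positive_point \<mu> \<le> ereal t} - rho2 w 0 / intensity w * t)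
           \<in> O[at_right 0](\<lambda>t. t\<^sup>2) \<and>
         rho2 w 0 / intensity w > 0"
proof -
  interpret retention \<alpha> \<beta> w by standard (use assms in auto)
  define l where "l = intensity w"
  define \<rho> where "\<rho> = rho2 w 0"
  have l: "0 < l" and \<rho>: "0 < \<rho>" using intensity_pos rho2_0_pos by (auto simp: l_def \<rho>_def)
  define p where "p t = measure P {\<mu> \<in> space P. first_positive_point \<mu> \<le> ereal t}" for t
  define c1 where "c1 = 2 / (pi\<^sup>2 * (2 * \<alpha>)^6) * (\<beta> - \<alpha>)\<^sup>2"
  define c2 where "c2 = 6 * (1 / (4 * pi * \<alpha>\<^sup>2)) ^ 3 * (\<beta> - \<alpha>)^3"
  \<comment> \<open>The errors are one-sided: \<open>c1\<close> controls the excess of the pair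
    integral over its leading term, \<open>c2\<close> the loss through triples.\<close>
  define C where "C = max c1 c2"
  have bound: "\<bar>p t - \<rho> / l * t\<bar> \<le> C / l * t\<^sup>2" if t: "t \<in> {0<..<1}" for t
  proof -
    define e where "e = (\<integral>\<^sup>+\<omega>. close_points t (X \<omega>) \<partial>\<Omega>)"
    note b = close_points_bounds[OF assms(5-7), of t, folded e_def]
    have C0: "0 \<le> C" using \<alpha> by (auto simp: C_def c1_def le_max_iff_disj)
    have t0: "0 \<le> t" "t \<le> 1" using t by auto
    have "l * p t = enn2real e"
      unfolding e_def p_def l_def using assms(7,8)
      by (intro reduced_palm_first_positive_point) (auto simp: projected_process_def)
    have "ennreal (\<rho> * t + c1 * t\<^sup>2) \<le> ennreal (\<rho> * t + C * t\<^sup>2)"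
      by (intro ennreal_leI add_left_mono mult_right_mono) (simp_all add: C_def)
    with b(1) pair_moment_le[OF t0, folded c1_def \<rho>_def] have up: "e \<le> ennreal (\<rho> * t + C * t\<^sup>2)"
      by (rule order.trans[OF order.trans])
    \<comment> \<open>Only now is the expectation known to be finite, so \<open>enn2real\<close> has
      lost nothing in the Palm identity.\<close>
    then have "e < \<top>" by (rule le_less_trans) simp
    then have e: "e = ennreal (l * p t)" unfolding \<open>l * p t = enn2real e\<close> by simp
    have lp: "0 \<le> l * p t" using l by (simp add: p_def)
    have "l * p t \<le> \<rho> * t + C * t\<^sup>2"
      using up C0 \<rho> t0 unfolding e by (subst (asm) ennreal_le_iff) auto
    moreover have "\<rho> * t \<le> l * p t + C * t\<^sup>2"
    proof -
      have "triple_moment t \<le> ennreal (C * t\<^sup>2)"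
        using triple_moment_le[OF t0(1), folded c2_def]
        by (rule order.trans) (intro ennreal_leI mult_right_mono, simp_all add: C_def)
      then have "e + triple_moment t \<le> ennreal (l * p t) + ennreal (C * t\<^sup>2)"
        unfolding e by (intro add_left_mono)
      then have "ennreal (\<rho> * t) \<le> ennreal (l * p t) + ennreal (C * t\<^sup>2)"
        using pair_moment_ge[OF t0(1)] b(2) unfolding \<rho>_def by (meson order.trans)
      also have "\<dots> = ennreal (l * p t + C * t\<^sup>2)" using lp C0 by (simp add: ennreal_plus)
      finally show ?thesis using lp C0 by (subst (asm) ennreal_le_iff) auto
    qed
    ultimately have "\<bar>l * p t - \<rho> * t\<bar> \<le> C * t\<^sup>2" by (simp add: abs_le_iff)
    then have "\<bar>l * p t - \<rho> * t\<bar> / l \<le> C * t\<^sup>2 / l" using l by (intro divide_right_mono) auto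
    moreover have "\<bar>l * p t - \<rho> * t\<bar> / l = \<bar>p t - \<rho> / l * t\<bar>"
    proof -
      have "\<bar>l * p t - \<rho> * t\<bar> / l = \<bar>(l * p t - \<rho> * t) / l\<bar>" using l by simp
      also have "(l * p t - \<rho> * t) / l = p t - \<rho> / l * t" using l by (simp add: diff_divide_distrib)
      finally show ?thesis .
    qed
    ultimately show ?thesis by simp
  qed
  have "(\<lambda>t. p t - \<rho> / l * t) \<in> O[at_right 0](\<lambda>t. t\<^sup>2)"
  proof (rule bigoI)
    show "\<forall>\<^sub>F t in at_right 0. norm (p t - \<rho> / l * t) \<le> C / l * norm (t\<^sup>2)"
      using eventually_at_right_real[of 0 "1 :: real"]
      by (rule eventually_mono) (use bound in auto)
  qed
  then show ?thesis using l \<rho> by (simp add: p_def l_def \<rho>_def)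
qed

end
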